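(* Let $d\geq 2$ be an integer and let $(p_n)_{n\geq 1}$ be a sequence of numbers in $[0,1]$. Consider independent long range bond percolation on $\mathbf{Z}^d$ in which each edge $\langle x,y\rangle$ parallel to a coordinate axis is open with probability $p_{|x-y|}$, independently of all other edges; for $N\in\mathbf{N}$, let $P_N$ denote the truncated percolation measure, in which each such edge is open, independently of all other edges, with probability $p_{|x-y|}$ if $|x-y|\leq N$ and with probability $0$ if $|x-y|>N$. If $$\limsup_{n\to\infty}p_n>0,$$ then there exists $N\in\mathbf{N}$ such that $$P_N(0\leftrightarrow\infty)>0.$$
   Context: The underlying graph has vertex set $\mathbf{Z}^d$ and edge set $\mathcal{E}$ consisting of all unordered pairs $\langle x,y\rangle$ of distinct vertices $x,y\in\mathbf{Z}^d$ that differ in exactly one coordinate (so edges of every length $n\geq 1$ parallel to the coordinate axes are present; for $d=2$ these are the horizontal and vertical edges of all lengths). Here $|x-y|$ is the length of the edge, i.e. the absolute value of the difference in the one coordinate where $x$ and $y$ differ. The configuration space is $\Omega=\{0,1\}^{\mathcal{E}}$ with the product $\sigma$-algebra; an edge $e$ is open in $\omega\in\Omega$ if $\omega_e=1$. The long range percolation measure is the product measure $P=\prod_{\langle x,y\rangle\in\mathcal{E}}\mu_{\langle x,y\rangle}$, where $\mu_{\langle x,y\rangle}$ is the Bernoulli measure on $\{0,1\}$ with $\mu_{\langle x,y\rangle}\{\omega_{\langle x,y\rangle}=1\}=p_{|x-y|}$. For $N\in\mathbf{N}$, the truncated sequence is $p_{N,n}=p_n$ if $n\leq N$ and $p_{N,n}=0$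 if $n>N$. The truncated measure is the product measure $P_N=\prod_{\langle x,y\rangle\in\mathcal{E}}\mu_{N,\langle x,y\rangle}$, where $\mu_{N,\langle x,y\rangle}$ is the Bernoulli measure on $\{0,1\}$ with $\mu_{N,\langle x,y\rangle}\{\omega_{\langle x,y\rangle}=1\}=p_{N,|x-y|}$. The event $\{0\leftrightarrow\infty\}$ is the event that the origin belongs to an infinite connected component of the subgraph of $(\mathbf{Z}^d,\mathcal{E})$ formed by the open edges. *)

theory Defs
  imports "HOL-Probability.Probability"
begin

text \<open>
  The lattice of dimension \<open>d\<close> is the type \<^typ>\<open>int ^ 'd\<close>, with \<open>CARD('d)\<close> in the role of \<open>d\<close>.
  An unordered pair of vertices is a two-element set of vertices.
\<close>

definition edges :: "(int ^ 'd) set set" where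
  "edges = {{x, y} | x y. \<exists>!i. x $ i \<noteq> y $ i}"

definition edge_length :: "(int ^ 'd) set \<Rightarrow> nat" where
  "edge_length e = (THE n. \<exists>x y i. e = {x, y} \<and> x $ i \<noteq> y $ i \<and> n = nat \<bar>x $ i - y $ i\<bar>)"

lemma edge_length_doubleton:
  fixes x y :: "int ^ 'd"
  assumes "\<exists>!i. x $ i \<noteq> y $ i" and "x $ i \<noteq> y $ i"
  shows "edge_length {x, y} = nat \<bar>x $ i - y $ i\<bar>"
  unfolding edge_length_def
proof (rule the_equality)
  show "\<exists>x' y' j. {x, y} = {x', y'} \<and> x' $ j \<noteq> y' $ j
      \<and> nat \<bar>x $ i - y $ i\<bar> = nat \<bar>x' $ j - y' $ j\<bar>"
    using assms(2) by blast
next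
  fix n
  assume "\<exists>x' y' j. {x, y} = {x', y'} \<and> x' $ j \<noteq> y' $ j \<and> n = nat \<bar>x' $ j - y' $ j\<bar>"
  then obtain x' y' j where h: "{x, y} = {x', y'}" "x' $ j \<noteq> y' $ j"
    "n = nat \<bar>x' $ j - y' $ j\<bar>" by blast
  from h(1) have c: "x' = x \<and> y' = y \<or> x' = y \<and> y' = x"
    by (auto simp: doubleton_eq_iff)
  with h(2) have "x $ j \<noteq> y $ j" by auto
  with assms have "j = i" by blast
  with c h(3) show "n = nat \<bar>x $ i - y $ i\<bar>" by (auto simp: abs_minus_commute)
qed

text \<open>
  A configuration maps edges to \<^typ>\<open>bool\<close>, with \<^const>\<open>True\<close> meaning open. The value \<open>p 0\<close> is
  never used, since every edge has positive length. Note that \<^const>\<open>bernoulli_pmf\<close> clips its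
  parameter to the unit interval.
\<close>

definition percolation :: "(nat \<Rightarrow> real) \<Rightarrow> ((int ^ 'd) set \<Rightarrow> bool) measure" where
  "percolation p = PiM edges (\<lambda>e. measure_pmf (bernoulli_pmf (p (edge_length e))))"

definition truncate :: "nat \<Rightarrow> (nat \<Rightarrow> real) \<Rightarrow> nat \<Rightarrow> real" where
  "truncate N p n = (if n \<le> N then p n else 0)"

definition truncated_percolation ::
  "nat \<Rightarrow> (nat \<Rightarrow> real) \<Rightarrow> ((int ^ 'd) set \<Rightarrow> bool) measure" where
  "truncated_percolation N p = percolation (truncate N p)"

definition cluster :: "((int ^ 'd) set \<Rightarrow> bool) \<Rightarrow> int ^ 'd \<Rightarrow> (int ^ 'd) set" where
  "cluster \<omega> x = {y. (x, y) \<in> {(u, v). {u, v} \<in> edges \<and> \<omega> {u, v}}\<^sup>*}"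

end

theory Submission imports Defs begin

text \<open>
  Choose lengths \<open>f 0, \<dots>, f m\<close> with \<open>p (f k) > \<epsilon>\<close> such that each exceeds the sum of the previous ones.
  Sums over subsets of \<open>{f 0, \<dots>, f (m - 1)}\<close> then embed a hypercube in a line, and translations by
  multiples of \<open>f m\<close> in two directions give disjoint copies of it, indexed by the sites of a quadrant.

  For large \<open>m\<close>, percolation on the hypercube has a component containing almost all vertices with
  high probability. Otherwise some \<open>A\<close> of intermediate size has a closed edge boundary, which happens
  with probability at most \<open>\<Sum>\<^sub>A y ^ \<bar>\<partial>A\<bar>\<close> where \<open>y = 1 - \<epsilon>\<close>. Since \<open>\<bar>\<partial>A\<bar>\<close> is at least proportional
  to \<open>2 ^ m\<close>, it suffices that the unrestricted sum grows more slowly than any \<open>c ^ (2 ^ m)\<close> with \<open>c > 1\<close>.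
  Splitting the directions into \<open>g\<close> blocks of size \<open>r\<close>, one block carries at most a fraction \<open>1 / g\<close> of
  the boundary, so the sum is at most \<open>g\<close> times the \<open>2 ^ (m - r)\<close>-th power of the same sum on an
  \<open>r\<close>-dimensional cube with \<open>y ^ g\<close> for \<open>y\<close>, and the latter is close to 2.

  Adjacent sites whose large components overlap are joined by many links of length \<open>f m\<close>, so good
  sites form a highly supercritical independent site percolation. It is treated by renormalisation:
  a box is good if at most one of its \<open>3 \<times> 3\<close> subboxes is bad, and the probability of a bad box
  is at most a constant times the square of that probability one scale below. If all boxes at the
  corner of the quadrant are good, their components form an infinite cluster. Translation invariance moves it
  to the origin.
\<close>

section \<open>Edge boundaries in the hypercube\<close>

text \<open>Each hypercube edge is listed once, as its lower endpoint \<open>h\<close> together with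
  its direction \<open>b\<close>. The separate set \<open>J\<close> allows counting only the cut
  edges inside a block of directions.\<close>

definition cube_cut :: "'a set \<Rightarrow> 'a set \<Rightarrow> 'a set set \<Rightarrow> ('a set \<times> 'a) set" where
  "cube_cut I J A = {(h, b). h \<subseteq> I \<and> b \<in> J \<and> b \<notin> h \<and> (h \<in> A) \<noteq> (insert b h \<in> A)}"

lemma finite_cube_cut: "finite I \<Longrightarrow> finite J \<Longrightarrow> finite (cube_cut I J A)"
  by (rule finite_subset[of _ "Pow I \<times> J"]) (auto simp: cube_cut_def)

text \<open>A weak edge-isoperimetric inequality, by induction on the dimension: the cut of
  \<open>A\<close> contains the cuts of its two slices in direction \<open>x\<close>, and one edge
  in direction \<open>x\<close> for each point where the slices differ.\<close>

lemma cube_cut_isoperimetry: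
  assumes "finite I" "A \<subseteq> Pow I"
  shows "min (card A) (2 ^ card I - card A) \<le> card (cube_cut I I A)"
  using assms
proof (induction I arbitrary: A rule: finite_induct)
  case empty
  then have "A = {} \<or> A = {{}}" by auto
  then show ?case by auto
next
  case (insert x I)
  define A0 where "A0 = A \<inter> Pow I"
  define A1 where "A1 = {h \<in> Pow I. insert x h \<in> A}"
  have fin: "finite A0" "finite A1" "finite A"
    using insert.hyps insert.prems finite_subset[OF insert.prems] by (auto simp: A0_def A1_def)
  have inj: "inj_on (insert x) (Pow I)"
    using insert.hyps by (intro inj_onI) (auto simp: insert_ident)
  have A: "A = A0 \<union> insert x ` A1"
  proof (intro equalityI subsetI)
    fix h assume h: "h \<in> A"
    show "h \<in> A0 \<union> insert x ` A1"
    proof (cases "x \<in> h")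
      case True
      with h insert.prems have "h - {x} \<in> A1" "h = insert x (h - {x})"
        by (auto simp: A1_def insert_absorb)
      then show ?thesis by blast
    qed (use h insert.prems in \<open>auto simp: A0_def\<close>)
  qed (auto simp: A0_def A1_def)
  have cA: "card A = card A0 + card A1"
  proof -
    have "A0 \<inter> insert x ` A1 = {}" using insert.hyps by (auto simp: A0_def)
    moreover have "card (insert x ` A1) = card A1"
      by (rule card_image, rule inj_on_subset[OF inj]) (auto simp: A1_def)
    ultimately show ?thesis
      using fin by (simp add: A card_Un_disjoint)
  qed
  let ?D = "(A0 - A1) \<union> (A1 - A0)"
  \<comment> \<open>Cut edges in the lower face, in the upper face, and between the two
    faces.\<close>
  define C0 where "C0 = cube_cut I I A0"
  define C1 where "C1 = (\<lambda>(h, b). (insert x h, b)) ` cube_cut I I A1"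
  define C2 where "C2 = (\<lambda>h. (h, x)) ` ?D"
  have finC: "finite C0" "finite C1" "finite C2"
    using fin insert.hyps by (auto simp: C0_def C1_def C2_def finite_cube_cut)
  have c1: "card C1 = card (cube_cut I I A1)"
    unfolding C1_def
  proof (rule card_image, rule inj_onI, clarsimp simp: cube_cut_def)
    fix h h' assume "h \<subseteq> I" "h' \<subseteq> I" "insert x h = insert x h'"
    then show "h = h'" using inj by (auto simp: inj_on_def)
  qed
  have c2: "card C2 = card (A0 - A1) + card (A1 - A0)"
    unfolding C2_def using fin
    by (subst card_image) (auto simp: inj_on_def intro!: card_Un_disjoint)
  have disj: "C0 \<inter> C1 = {}" "(C0 \<union> C1) \<inter> C2 = {}"
    using insert.hyps by (auto simp: C0_def C1_def C2_def cube_cut_def)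
  have "C0 \<union> C1 \<union> C2 \<subseteq> cube_cut (insert x I) (insert x I) A"
  proof -
    have "C0 \<subseteq> cube_cut (insert x I) (insert x I) A"
      by (auto simp: C0_def cube_cut_def A0_def)
    moreover have "C1 \<subseteq> cube_cut (insert x I) (insert x I) A"
      using insert.hyps by (auto simp: C1_def cube_cut_def A1_def insert_commute)
    moreover have "C2 \<subseteq> cube_cut (insert x I) (insert x I) A"
      using insert.hyps by (auto simp: C2_def cube_cut_def A0_def A1_def)
    ultimately show ?thesis by blast
  qed
  then have "card (C0 \<union> C1 \<union> C2) \<le> card (cube_cut (insert x I) (insert x I) A)"
    using insert.hyps by (intro card_mono finite_cube_cut) auto
  then have le: "card (cube_cut I I A0) + card (cube_cut I I A1) + card (A0 - A1) + card (A1 - A0)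
      \<le> card (cube_cut (insert x I) (insert x I) A)"
    using finC disj c1 c2 by (simp add: card_Un_disjoint C0_def)
  have "card A0 \<le> card A1 + card (A0 - A1)" "card A1 \<le> card A0 + card (A1 - A0)"
    using fin card_Un_le[of A1 "A0 - A1"] card_Un_le[of A0 "A1 - A0"]
      card_mono[of "A1 \<union> (A0 - A1)" A0] card_mono[of "A0 \<union> (A1 - A0)" A1]
    by (auto intro: order_trans)
  moreover have "min (card A0) (2 ^ card I - card A0) \<le> card (cube_cut I I A0)"
      "min (card A1) (2 ^ card I - card A1) \<le> card (cube_cut I I A1)"
    by (rule insert.IH; auto simp: A0_def A1_def)+
  moreover have "card A0 \<le> 2 ^ card I" "card A1 \<le> 2 ^ card I"
    using insert.hyps card_mono[of "Pow I" A0] card_mono[of "Pow I" A1]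
    by (auto simp: A0_def A1_def card_Pow)
  \<comment> \<open>If both slices lie on the same side of half a face, their two minima add up to
    the bound. Otherwise the minima and the difference of the sizes add up to at least
    \<open>2 ^ card I\<close>, the largest value the left side can take.\<close>
  ultimately have "min (card A0 + card A1) (2 * 2 ^ card I - (card A0 + card A1))
      \<le> card (cube_cut (insert x I) (insert x I) A)"
    using le by linarith
  then show ?case
    using insert.hyps by (simp add: cA)
qed

lemma cube_cut_nonempty:
  assumes "finite I" "A \<subseteq> Pow I" "A \<noteq> {}" "A \<noteq> Pow I"
  shows "card (cube_cut I I A) \<ge> 1"
proof -
  have "card A < card (Pow I)"
    using assms by (intro psubset_card_mono) auto
  moreover have "card A > 0"
    using assms by (auto simp: card_gt_0_iff intro: finite_subset)
  ultimately show ?thesis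
    using cube_cut_isoperimetry[OF assms(1,2)] assms(1) by (simp add: card_Pow)
qed

text \<open>This is the partition function of the Ising model on the hypercube, with interactions only
  in the directions \<open>J\<close>.\<close>

definition cut_sum :: "'a set \<Rightarrow> 'a set \<Rightarrow> real \<Rightarrow> real" where
  "cut_sum I J y = (\<Sum>A\<in>Pow (Pow I). y ^ card (cube_cut I J A))"

text \<open>Only \<open>{}\<close> and \<open>Pow I\<close> have an empty cut. Each of them
  contributes 1 and every other set at most \<open>y\<close>, so the sum is close to 2 for tiny
  \<open>y\<close>.\<close>

lemma cut_sum_le:
  assumes "finite I" "0 \<le> y" "y \<le> 1"
  shows "cut_sum I I y \<le> 2 + 2 ^ (2 ^ card I) * y"
proof -
  have fin: "finite (Pow (Pow I))" using assms by simp
  have "cut_sum I I y \<le> (\<Sum>A\<in>Pow (Pow I). of_bool (A = {}) + of_bool (A = Pow I) + y)"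
    unfolding cut_sum_def
  proof (rule sum_mono)
    fix A assume A: "A \<in> Pow (Pow I)"
    show "y ^ card (cube_cut I I A) \<le> of_bool (A = {}) + of_bool (A = Pow I) + y"
    proof (cases "A = {} \<or> A = Pow I")
      case True
      have "y ^ card (cube_cut I I A) \<le> 1" using assms by (simp add: power_le_one)
      with True assms show ?thesis by auto
    next
      case False
      then have "card (cube_cut I I A) \<ge> 1" using A assms by (intro cube_cut_nonempty) auto
      then have "y ^ card (cube_cut I I A) \<le> y ^ 1" using assms by (intro power_decreasing) auto
      with False show ?thesis by simp
    qed
  qed
  also have "\<dots> = 2 + 2 ^ (2 ^ card I) * y"
    using fin assms by (simp add: sum.distrib card_Pow of_bool_def)
  finally show ?thesis .
qed

text \<open>With interactions only in the directions \<open>J\<close>, the slices of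
  \<open>A\<close> over different \<open>u \<subseteq> I - J\<close> do not interact. The weight is
  a product over slices, and summing the slices independently gives one factor for each
  \<open>u\<close>.\<close>

lemma cut_sum_product_le:
  assumes "finite I" "J \<subseteq> I" "0 \<le> y"
  shows "cut_sum I J y \<le> cut_sum J J y ^ (2 ^ (card I - card J))"
proof -
  define U where "U = Pow (I - J)"
  \<comment> \<open>The family of slices of \<open>A\<close>; it determines \<open>A\<close>, whence
    the injectivity below.\<close>
  define sl where "sl A = (\<lambda>u\<in>U. {v \<in> Pow J. u \<union> v \<in> A})" for A
  have finJ: "finite J" by (rule finite_subset[OF assms(2,1)])
  have finU: "finite U" using assms by (simp add: U_def)
  have cU: "card U = 2 ^ (card I - card J)"
    using assms finJ by (simp add: U_def card_Pow card_Diff_subset)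
  have inj: "inj_on sl (Pow (Pow I))"
  proof (rule inj_onI)
    fix A B assume A: "A \<in> Pow (Pow I)" and B: "B \<in> Pow (Pow I)" and eq: "sl A = sl B"
    have "h \<in> A \<longleftrightarrow> h \<in> B" if "h \<subseteq> I" for h
    proof -
      have "(h - J) \<in> U" using that by (auto simp: U_def)
      then have "{v \<in> Pow J. (h - J) \<union> v \<in> A} = {v \<in> Pow J. (h - J) \<union> v \<in> B}"
        using fun_cong[OF eq, of "h - J"] by (simp add: sl_def)
      then have "h \<inter> J \<in> {v \<in> Pow J. (h - J) \<union> v \<in> A}
          \<longleftrightarrow> h \<inter> J \<in> {v \<in> Pow J. (h - J) \<union> v \<in> B}" by (simp only:)
      then show ?thesis by (simp add: Un_Diff_Int)
    qed
    show "A = B"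
    proof (rule set_eqI)
      fix h show "h \<in> A \<longleftrightarrow> h \<in> B"
      proof (cases "h \<subseteq> I")
        case False
        then show ?thesis using A B by auto
      qed fact
    qed
  qed
  have slPi: "sl ` Pow (Pow I) \<subseteq> PiE U (\<lambda>_. Pow (Pow J))"
    by (auto simp: sl_def PiE_def extensional_def)
  have sl: "v \<in> sl A u \<longleftrightarrow> v \<subseteq> J \<and> u \<union> v \<in> A" if "u \<in> U" for A u v
    using that by (simp add: sl_def)
  have cc: "card (cube_cut I J A) = (\<Sum>u\<in>U. card (cube_cut J J (sl A u)))" for A
  proof -
    have "bij_betw (\<lambda>(u, v, b). (u \<union> v, b)) (SIGMA u:U. cube_cut J J (sl A u)) (cube_cut I J A)"
    proof (rule bij_betwI[where g = "\<lambda>(h, b). (h - J, h \<inter> J, b)"])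
      show "(\<lambda>(u, v, b). (u \<union> v, b)) \<in> (SIGMA u:U. cube_cut J J (sl A u)) \<rightarrow> cube_cut I J A"
      proof (rule funcsetI)
        fix x assume "x \<in> (SIGMA u:U. cube_cut J J (sl A u))"
        then obtain u v b where x: "x = (u, v, b)" and h: "u \<in> U" "v \<subseteq> J" "b \<in> J" "b \<notin> v"
            "(v \<in> sl A u) \<noteq> (insert b v \<in> sl A u)"
          by (auto simp: cube_cut_def)
        from h have "u \<union> v \<subseteq> I" "b \<notin> u \<union> v" using assms(2) by (auto simp: U_def)
        moreover from h have "(u \<union> v \<in> A) \<noteq> (insert b (u \<union> v) \<in> A)" by (simp add: sl)
        ultimately show "(\<lambda>(u, v, b). (u \<union> v, b)) x \<in> cube_cut I J A"
          using h(3) by (simp add: x cube_cut_def)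
      qed
    next
      show "(\<lambda>(h, b). (h - J, h \<inter> J, b)) \<in> cube_cut I J A \<rightarrow> (SIGMA u:U. cube_cut J J (sl A u))"
      proof (rule funcsetI)
        fix x assume "x \<in> cube_cut I J A"
        then obtain h b where x: "x = (h, b)" and h: "h \<subseteq> I" "b \<in> J" "b \<notin> h"
            "(h \<in> A) \<noteq> (insert b h \<in> A)"
          by (auto simp: cube_cut_def)
        then have "h - J \<in> U" by (auto simp: U_def)
        moreover have "(h - J) \<union> insert b (h \<inter> J) = insert b h" using h by auto
        ultimately show "(\<lambda>(h, b). (h - J, h \<inter> J, b)) x \<in> (SIGMA u:U. cube_cut J J (sl A u))"
          using h by (simp add: x cube_cut_def sl Un_Diff_Int)
      qed
    next
      fix x assume "x \<in> (SIGMA u:U. cube_cut J J (sl A u))"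
      then obtain u v b where x: "x = (u, v, b)" "u \<subseteq> I - J" "v \<subseteq> J"
        by (auto simp: cube_cut_def U_def)
      then have "u \<union> v - J = u" "(u \<union> v) \<inter> J = v" by auto
      with x show "(\<lambda>(h, b). (h - J, h \<inter> J, b)) ((\<lambda>(u, v, b). (u \<union> v, b)) x) = x"
        by simp
    next
      fix x assume "x \<in> cube_cut I J A"
      then show "(\<lambda>(u, v, b). (u \<union> v, b)) ((\<lambda>(h, b). (h - J, h \<inter> J, b)) x) = x"
        by (cases x) (simp add: Un_Diff_Int)
    qed
    then have "card (cube_cut I J A) = card (SIGMA u:U. cube_cut J J (sl A u))"
      by (metis bij_betw_same_card)
    also have "\<dots> = (\<Sum>u\<in>U. card (cube_cut J J (sl A u)))"
      using finU finJ by (intro card_SigmaI) (auto simp: finite_cube_cut)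
    finally show ?thesis .
  qed
  have "cut_sum I J y = (\<Sum>A\<in>Pow (Pow I). \<Prod>u\<in>U. y ^ card (cube_cut J J (sl A u)))"
    unfolding cut_sum_def by (simp add: cc power_sum)
  also have "\<dots> = (\<Sum>F\<in>sl ` Pow (Pow I). \<Prod>u\<in>U. y ^ card (cube_cut J J (F u)))"
    by (subst sum.reindex[OF inj]) simp
  also have "\<dots> \<le> (\<Sum>F\<in>PiE U (\<lambda>_. Pow (Pow J)). \<Prod>u\<in>U. y ^ card (cube_cut J J (F u)))"
    using slPi finU finJ assms by (intro sum_mono2 finite_PiE prod_nonneg) auto
  also have "\<dots> = (\<Prod>u\<in>U. cut_sum J J y)"
    unfolding cut_sum_def using finU finJ by (subst prod_sum_PiE) auto
  also have "\<dots> = cut_sum J J y ^ (2 ^ (card I - card J))"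
    by (simp add: cU)
  finally show ?thesis .
qed

text \<open>The blocks split the cut into \<open>g\<close> disjoint pieces, the smallest of which
  has at most a fraction \<open>1 / g\<close> of the edges. Which block this is depends on
  \<open>A\<close>; summing over all \<open>j\<close> removes the dependence.\<close>

lemma cut_sum_blocks_le:
  assumes y: "0 \<le> y" "y \<le> 1" and g: "g > 0"
  shows "cut_sum {..<g * r} {..<g * r} y
    \<le> (\<Sum>j<g. cut_sum {..<g * r} {j * r..<Suc j * r} (y ^ g))"
proof -
  let ?I = "{..<g * r}"
  let ?c = "\<lambda>A j. card (cube_cut ?I {j * r..<Suc j * r} A)"
  have "y ^ card (cube_cut ?I ?I A) \<le> (\<Sum>j<g. (y ^ g) ^ ?c A j)" for A
  proof -
    have "Min (?c A ` {..<g}) \<in> ?c A ` {..<g}" using g by (intro Min_in) auto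
    then obtain i where i: "i < g" "Min (?c A ` {..<g}) = ?c A i" by auto
    have mn: "?c A i \<le> ?c A j" if "j < g" for j
    proof -
      have "Min (?c A ` {..<g}) \<le> ?c A j" using that by (intro Min_le) auto
      then show ?thesis by (simp only: i(2))
    qed
    have dj: "disjoint_family_on (\<lambda>j. cube_cut ?I {j * r..<Suc j * r} A) {..<g}"
    proof -
      have "j = j'" if "j * r \<le> b" "b < Suc j * r" "j' * r \<le> b" "b < Suc j' * r" for b j j'
      proof -
        have "b div r = k" if "k * r \<le> b" "b < Suc k * r" for k
          using that by (intro div_nat_eqI) (auto simp: mult.commute)
        with that show ?thesis by metis
      qed
      then show ?thesis by (fastforce simp: disjoint_family_on_def cube_cut_def)
    qed
    have "g * ?c A i = (\<Sum>j<g. ?c A i)" by simp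
    also have "\<dots> \<le> (\<Sum>j<g. ?c A j)" by (rule sum_mono) (use mn in auto)
    also have "\<dots> = card (\<Union>j<g. cube_cut ?I {j * r..<Suc j * r} A)"
      using dj by (intro card_UN_disjoint'[symmetric]) (auto simp: finite_cube_cut)
    also have "\<dots> \<le> card (cube_cut ?I ?I A)"
    proof (rule card_mono)
      have "Suc j * r \<le> g * r" if "j < g" for j using that by (intro mult_le_mono1) auto
      then show "(\<Union>j<g. cube_cut ?I {j * r..<Suc j * r} A) \<subseteq> cube_cut ?I ?I A"
        by (fastforce simp: cube_cut_def)
    qed (simp add: finite_cube_cut)
    finally have "y ^ card (cube_cut ?I ?I A) \<le> y ^ (g * ?c A i)"
      using y by (intro power_decreasing) auto
    also have "\<dots> = (y ^ g) ^ ?c A i" by (simp add: power_mult)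
    also have "\<dots> \<le> (\<Sum>j<g. (y ^ g) ^ ?c A j)"
      using i y by (intro member_le_sum) auto
    finally show ?thesis .
  qed
  then have "cut_sum ?I ?I y \<le> (\<Sum>A\<in>Pow (Pow ?I). \<Sum>j<g. (y ^ g) ^ ?c A j)"
    unfolding cut_sum_def by (rule sum_mono)
  also have "\<dots> = (\<Sum>j<g. cut_sum ?I {j * r..<Suc j * r} (y ^ g))"
    unfolding cut_sum_def by (rule sum.swap)
  finally show ?thesis .
qed

text \<open>The block size \<open>r\<close> is fixed first, with \<open>3 \<le> c ^ (2 ^ r)\<close>.
  Only then is \<open>g\<close> taken so large that the cut sum of a single block with weight
  \<open>y ^ g\<close> is at most 3; the product over slices turns this into the claim.\<close>

lemma cut_sum_subexponential:
  fixes y c :: real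
  assumes y: "0 \<le> y" "y < 1" and c: "c > 1"
  obtains r g0 where "r > 0"
    "\<And>g. g \<ge> g0 \<Longrightarrow> cut_sum {..<g * r} {..<g * r} y \<le> real g * c ^ (2 ^ (g * r))"
proof -
  obtain r0 where r0: "3 < c ^ r0" using real_arch_pow[OF c] by blast
  define r where "r = Suc r0"
  have "r0 \<le> 2 ^ r" using less_exp[of r] by (simp add: r_def)
  then have r: "3 \<le> c ^ (2 ^ r)"
    using r0 c power_increasing[of r0 "2 ^ r" c] by linarith
  \<comment> \<open>Below this threshold the error term of \<open>cut_sum_le\<close> for a block of
    size \<open>r\<close> is at most 1.\<close>
  define e :: real where "e = 1 / 2 ^ (2 ^ r)"
  have "(\<lambda>g. y ^ g) \<longlonglongrightarrow> 0" using y by (intro LIMSEQ_power_zero) auto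
  then have "eventually (\<lambda>g. y ^ g < e) sequentially"
    by (rule order_tendstoD) (simp add: e_def)
  then obtain g1 where g1: "\<And>g. g \<ge> g1 \<Longrightarrow> y ^ g < e"
    by (auto simp: eventually_sequentially)
  have "cut_sum {..<g * r} {..<g * r} y \<le> real g * c ^ (2 ^ (g * r))" if g: "g \<ge> Suc g1" for g
  proof -
    let ?I = "{..<g * r}"
    have "cut_sum ?I {j * r..<Suc j * r} (y ^ g) \<le> c ^ (2 ^ (g * r))" if j: "j < g" for j
    proof -
      let ?J = "{j * r..<Suc j * r}"
      have JI: "?J \<subseteq> ?I"
        using mult_le_mono1[of "Suc j" g r] j by auto
      have le: "r \<le> g * r" using g by (cases g) auto
      have "cut_sum ?J ?J (y ^ g) \<le> 2 + 2 ^ (2 ^ card ?J) * y ^ g"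
        using y by (intro cut_sum_le) (auto simp: power_le_one)
      also have "\<dots> \<le> 3"
        using g1[of g] g by (simp add: e_def field_simps)
      finally have J3: "cut_sum ?J ?J (y ^ g) \<le> 3" .
      have "cut_sum ?I ?J (y ^ g) \<le> cut_sum ?J ?J (y ^ g) ^ (2 ^ (card ?I - card ?J))"
        using JI y by (intro cut_sum_product_le) auto
      also have "\<dots> \<le> (c ^ (2 ^ r)) ^ (2 ^ (card ?I - card ?J))"
        using J3 r y by (intro power_mono) (auto simp: cut_sum_def intro!: sum_nonneg)
      also have "\<dots> = c ^ (2 ^ (g * r))"
        using le by (simp flip: power_mult power_add)
      finally show ?thesis .
    qed
    then have "(\<Sum>j<g. cut_sum ?I {j * r..<Suc j * r} (y ^ g)) \<le> (\<Sum>j<g. c ^ (2 ^ (g * r)))"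
      by (intro sum_mono) auto
    then show ?thesis
      using cut_sum_blocks_le[of y g r] y g by simp
  qed
  then show ?thesis using that[of r "Suc g1"] by (simp add: r_def)
qed

section \<open>Union bounds and the choice of the cube dimension\<close>

lemma sum_power_card_Pow:
  fixes x :: real
  assumes "finite V"
  shows "(\<Sum>S\<in>Pow V. x ^ card S) = (1 + x) ^ card V"
  using prod_add[OF assms, of "\<lambda>_. x" "\<lambda>_. 1"] by (simp add: add.commute)

text \<open>A Chernoff bound: the factor \<open>z powr (card S - (1 - t) * card V)\<close> is at
  least 1 on the sets in question, and once it is inserted the sum can be extended to all subsets,
  where it is binomial.\<close>

lemma sum_power_large_sets_le:
  fixes y z t :: real
  assumes "finite V" "0 \<le> y" "z \<ge> 1"
  shows "(\<Sum>S | S \<subseteq> V \<and> (1 - t) * card V \<le> card S. y ^ card S)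
    \<le> ((1 / z + y) * z powr t) ^ card V"
proof -
  let ?n = "card V"
  have zpos: "z > 0" using assms by simp
  have "(\<Sum>S | S \<subseteq> V \<and> (1 - t) * ?n \<le> card S. y ^ card S)
      \<le> (\<Sum>S | S \<subseteq> V \<and> (1 - t) * ?n \<le> card S. z powr (- ((1 - t) * ?n)) * (y * z) ^ card S)"
  proof (rule sum_mono)
    fix S assume "S \<in> {S. S \<subseteq> V \<and> (1 - t) * ?n \<le> card S}"
    then have "1 \<le> z powr (card S - (1 - t) * ?n)"
      using assms by (intro ge_one_powr_ge_zero) auto
    also have "\<dots> = z powr (- ((1 - t) * ?n)) * z ^ card S"
      using zpos by (simp add: algebra_simps flip: powr_realpow powr_add)
    finally have "y ^ card S * 1 \<le> y ^ card S * (z powr (- ((1 - t) * ?n)) * z ^ card S)"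
      using assms by (intro mult_left_mono) auto
    then show "y ^ card S \<le> z powr (- ((1 - t) * ?n)) * (y * z) ^ card S"
      by (simp add: power_mult_distrib mult_ac)
  qed
  also have "\<dots> \<le> (\<Sum>S\<in>Pow V. z powr (- ((1 - t) * ?n)) * (y * z) ^ card S)"
    using assms by (intro sum_mono2) auto
  also have "\<dots> = z powr (- ((1 - t) * ?n)) * (1 + y * z) ^ ?n"
    by (simp add: sum_power_card_Pow[OF assms(1)] flip: sum_distrib_left)
  also have "z powr (- ((1 - t) * ?n)) = (z powr (t - 1)) ^ ?n"
    using zpos by (simp add: powr_power algebra_simps)
  also have "(z powr (t - 1)) ^ ?n * (1 + y * z) ^ ?n = ((1 / z + y) * z powr t) ^ ?n"
    using zpos by (simp add: powr_diff field_simps flip: power_mult_distrib)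
  finally show ?thesis .
qed

text \<open>The weight \<open>y\<close> is split into two factors \<open>sqrt y\<close>. One pays
  for the \<open>d * 2 ^ m\<close> cut edges guaranteed by isoperimetry, the other is summed over
  all sets.\<close>

lemma sum_middle_cuts_le:
  fixes y d :: real
  assumes y: "0 < y" "y < 1" and d: "0 < d" "d \<le> 1 / 2"
  shows "(\<Sum>A | A \<subseteq> Pow {..<m} \<and> d * 2 ^ m \<le> card A \<and> card A \<le> (1 - d) * 2 ^ m.
      y ^ card (cube_cut {..<m} {..<m} A)) \<le> (sqrt y powr d) ^ (2 ^ m) * cut_sum {..<m} {..<m} (sqrt y)"
proof -
  let ?I = "{..<m}" and ?s = "sqrt y"
  let ?M = "{A. A \<subseteq> Pow ?I \<and> d * 2 ^ m \<le> card A \<and> card A \<le> (1 - d) * 2 ^ m}"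
  have s: "0 < ?s" "?s < 1" using y by auto
  have "(\<Sum>A\<in>?M. y ^ card (cube_cut ?I ?I A))
      \<le> (\<Sum>A\<in>?M. (?s powr d) ^ (2 ^ m) * ?s ^ card (cube_cut ?I ?I A))"
  proof (rule sum_mono)
    fix A assume A: "A \<in> ?M"
    let ?c = "card (cube_cut ?I ?I A)"
    have "min (card A) (2 ^ m - card A) \<le> ?c"
      using A cube_cut_isoperimetry[of ?I A] by auto
    moreover have "card A \<le> 2 ^ m"
      using A card_mono[of "Pow ?I" A] by (auto simp: card_Pow)
    moreover define N :: nat where "N = 2 ^ m"
    ultimately have "min (real (card A)) (real N - real (card A)) \<le> ?c"
      by linarith
    then have "min (real (card A)) (2 ^ m - real (card A)) \<le> ?c"
      by (simp add: N_def)
    moreover have "d * 2 ^ m \<le> min (real (card A)) (2 ^ m - real (card A))"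
      using A by (auto simp: algebra_simps)
    ultimately have "d * 2 ^ m \<le> ?c" by linarith
    then have "?s powr real ?c \<le> ?s powr (d * 2 ^ m)"
      using s by (intro powr_mono') auto
    then have "?s ^ ?c \<le> (?s powr d) ^ (2 ^ m)"
      using s by (simp add: powr_realpow powr_power mult.commute)
    then have "?s ^ ?c * ?s ^ ?c \<le> (?s powr d) ^ (2 ^ m) * ?s ^ ?c"
      using s by (intro mult_right_mono) auto
    moreover have "?s ^ ?c * ?s ^ ?c = y ^ ?c"
      using y by (simp flip: power_mult_distrib)
    ultimately show "y ^ ?c \<le> (?s powr d) ^ (2 ^ m) * ?s ^ ?c" by simp
  qed
  also have "\<dots> \<le> (\<Sum>A\<in>Pow (Pow ?I). (?s powr d) ^ (2 ^ m) * ?s ^ card (cube_cut ?I ?I A))"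
    using s by (intro sum_mono2) auto
  also have "\<dots> = (?s powr d) ^ (2 ^ m) * cut_sum ?I ?I ?s"
    by (simp add: cut_sum_def sum_distrib_left)
  finally show ?thesis .
qed

text \<open>The two sums bound the two ways in which a site can fail. First \<open>d\<close> is
  taken small for the sake of the second sum, then \<open>m = g * r\<close> large for both.\<close>

lemma exists_cube_parameters:
  fixes y \<eta> :: real
  assumes y: "0 < y" "y < 1" and "\<eta> > 0"
  obtains d :: real and m :: nat where "0 < d" "d \<le> 1 / 3"
    "(\<Sum>A | A \<subseteq> Pow {..<m} \<and> d * 2 ^ m \<le> card A \<and> card A \<le> (1 - d) * 2 ^ m.
        y ^ card (cube_cut {..<m} {..<m} A)) \<le> \<eta>"
    "(\<Sum>S | S \<subseteq> Pow {..<m} \<and> (1 - 2 * d) * 2 ^ m \<le> card S. y ^ card S) \<le> \<eta>"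
proof -
  \<comment> \<open>This choice gives \<open>1 / z + y = (1 + y) / 2\<close>, leaving room below 1
    for the factor \<open>z powr (2 * d)\<close>.\<close>
  define z where "z = 2 / (1 - y)"
  have z: "z \<ge> 1" using y by (simp add: z_def field_simps)
  have zy: "1 / z + y < 1" "1 / z + y > 0" using y by (auto simp: z_def field_simps)
  have "((\<lambda>d. (1 / z + y) * z powr (2 * d)) \<longlongrightarrow> (1 / z + y) * z powr (2 * 0)) (at_right 0)"
    using z by (intro tendsto_intros) auto
  then have "eventually (\<lambda>d. (1 / z + y) * z powr (2 * d) < 1) (at_right 0)"
    using zy z by (intro order_tendstoD(2)[where a = 1]) auto
  moreover have "eventually (\<lambda>d::real. d \<in> {0<..<1/3}) (at_right 0)"
    by (rule eventually_at_right_real) simp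
  ultimately have "eventually (\<lambda>d. (1 / z + y) * z powr (2 * d) < 1 \<and> d \<in> {0<..<1/3}) (at_right 0)"
    by (rule eventually_conj)
  then obtain d where d: "(1 / z + y) * z powr (2 * d) < 1" "0 < d" "d < 1 / 3"
    using eventually_happens[of _ "at_right (0::real)"] by (auto simp: trivial_limit_at_right_real)
  define \<theta>2 where "\<theta>2 = (1 / z + y) * z powr (2 * d)"
  have t2: "0 \<le> \<theta>2" "\<theta>2 < 1" using d zy by (auto simp: \<theta>2_def)
  define s where "s = sqrt y"
  have s: "0 < s" "s < 1" using y by (auto simp: s_def)
  \<comment> \<open>As \<open>s powr d = \<theta>1 * \<theta>1\<close>, growth of the cut sum at
    rate \<open>1 / \<theta>1\<close> uses up one factor and leaves
    \<open>\<theta>1 ^ (2 ^ m)\<close>.\<close>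
  define \<theta>1 where "\<theta>1 = s powr (d / 2)"
  have t1: "0 < \<theta>1" "\<theta>1 < 1" using s d powr_less_mono2[of "d / 2" s 1] by (auto simp: \<theta>1_def)
  have ss: "s powr d = \<theta>1 * \<theta>1" by (simp add: \<theta>1_def flip: powr_add)
  obtain r g0 where r: "r > 0" and g0:
    "\<And>g. g \<ge> g0 \<Longrightarrow> cut_sum {..<g * r} {..<g * r} s \<le> real g * (1 / \<theta>1) ^ (2 ^ (g * r))"
    using cut_sum_subexponential[of s "1 / \<theta>1"] s t1 by auto
  have "(\<lambda>g. real g * \<theta>1 ^ g) \<longlonglongrightarrow> 0"
    using t1 by (intro powser_times_n_limit_0) auto
  then have e1: "eventually (\<lambda>g. real g * \<theta>1 ^ g < \<eta>) sequentially"
    using assms by (intro order_tendstoD(2)) auto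
  have "(\<lambda>g. \<theta>2 ^ g) \<longlonglongrightarrow> 0"
    using t2 by (intro LIMSEQ_power_zero) auto
  then have e2: "eventually (\<lambda>g. \<theta>2 ^ g < \<eta>) sequentially"
    using assms by (intro order_tendstoD(2)) auto
  have "eventually (\<lambda>g. real g * \<theta>1 ^ g < \<eta> \<and> \<theta>2 ^ g < \<eta> \<and> g \<ge> g0) sequentially"
    using e1 e2 eventually_ge_at_top[of g0] by eventually_elim auto
  then obtain g where g: "real g * \<theta>1 ^ g < \<eta>" "\<theta>2 ^ g < \<eta>" "g \<ge> g0"
    by (auto simp: eventually_sequentially)
  define m where "m = g * r"
  have "g \<le> m" using r by (simp add: m_def)
  also have "m \<le> 2 ^ m" using less_exp[of m] by simp
  finally have gm: "g \<le> 2 ^ m" .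
  show ?thesis
  proof (rule that[where d = d and m = m])
    have "(\<Sum>A | A \<subseteq> Pow {..<m} \<and> d * 2 ^ m \<le> card A \<and> card A \<le> (1 - d) * 2 ^ m.
        y ^ card (cube_cut {..<m} {..<m} A)) \<le> (s powr d) ^ (2 ^ m) * cut_sum {..<m} {..<m} s"
      unfolding s_def using y d by (intro sum_middle_cuts_le) auto
    also have "\<dots> \<le> (s powr d) ^ (2 ^ m) * (real g * (1 / \<theta>1) ^ (2 ^ m))"
      using g0[OF g(3)] by (intro mult_left_mono) (auto simp: m_def)
    also have "\<dots> = real g * \<theta>1 ^ (2 ^ m)"
      using t1 by (simp add: ss power_mult_distrib power_one_over field_simps)
    also have "\<dots> \<le> real g * \<theta>1 ^ g"
      using t1 gm by (intro mult_left_mono power_decreasing) auto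
    finally show "(\<Sum>A | A \<subseteq> Pow {..<m} \<and> d * 2 ^ m \<le> card A \<and> card A \<le> (1 - d) * 2 ^ m.
        y ^ card (cube_cut {..<m} {..<m} A)) \<le> \<eta>" using g by simp
    have "(\<Sum>S | S \<subseteq> Pow {..<m} \<and> (1 - 2 * d) * 2 ^ m \<le> card S. y ^ card S) \<le> \<theta>2 ^ (2 ^ m)"
      using sum_power_large_sets_le[of "Pow {..<m}" y z "2 * d"] y z
      by (simp add: card_Pow \<theta>2_def)
    also have "\<dots> \<le> \<theta>2 ^ g"
      using t2 gm by (intro power_decreasing) auto
    finally show "(\<Sum>S | S \<subseteq> Pow {..<m} \<and> (1 - 2 * d) * 2 ^ m \<le> card S. y ^ card S) \<le> \<eta>"
      using g by simp
  qed (use d in auto)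
qed

section \<open>Extraction of a giant component\<close>

text \<open>Meant for \<open>f\<close> sending a hypercube vertex to its component: if no union of
  components has intermediate size, a single component is large.\<close>

lemma large_fibre:
  fixes f :: "'v \<Rightarrow> 'l" and d :: real
  assumes V: "finite V" "V \<noteq> {}" and d: "0 < d" "d \<le> 1 / 3"
    and gap: "\<And>L. \<not> (d * card V \<le> card {v \<in> V. f v \<in> L} \<and> card {v \<in> V. f v \<in> L} \<le> (1 - d) * card V)"
  obtains c where "card {v \<in> V. f v = c} > (1 - d) * card V"
proof -
  define w where "w L = card {v \<in> V. f v \<in> L}" for L
  \<comment> \<open>Take a smallest large union of fibres: removing one fibre leaves less than \<open>d * card V\<close> points.\<close>
  define P where "P L \<longleftrightarrow> finite L \<and> w L > (1 - d) * card V" for L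
  have n: "card V > 0" using V by (auto simp: card_gt_0_iff)
  have "w (f ` V) = card V" by (auto simp: w_def intro: arg_cong[where f = card])
  then have "P (f ` V)" using V d n by (simp add: P_def)
  then obtain L where L: "P L" and min: "\<And>L'. P L' \<Longrightarrow> card L \<le> card L'"
    using arg_min_nat_lemma[of P "f ` V" card] by blast
  have "w {} = 0" by (simp add: w_def)
  then have "L \<noteq> {}" using L d n by (auto simp: P_def mult_less_0_iff)
  then obtain c where c: "c \<in> L" by auto
  have fL: "finite L" using L by (simp add: P_def)
  then have "card (L - {c}) < card L" using c by (rule card_Diff1_less)
  then have "\<not> P (L - {c})" using min leD by blast
  then have "w (L - {c}) < d * card V"
    using gap[of "L - {c}"] fL by (auto simp: P_def w_def)
  moreover have "w L \<le> w (L - {c}) + w {c}"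
  proof -
    have "{v \<in> V. f v \<in> L} \<subseteq> {v \<in> V. f v \<in> L - {c}} \<union> {v \<in> V. f v \<in> {c}}" by auto
    then show ?thesis
      unfolding w_def using V by (intro order_trans[OF card_mono card_Un_le]) auto
  qed
  ultimately have "w {c} > (1 - d) * card V - d * card V"
    using L by (simp add: P_def)
  \<comment> \<open>From \<open>d \<le> 1 / 3\<close> follows \<open>1 - 2 * d \<ge> d\<close>, so
    the removed fibre is not small and must be large by \<open>gap\<close>.\<close>
  moreover have "(1 - d) * card V - d * card V \<ge> d * card V"
    using d n by (simp add: algebra_simps)
  ultimately have "w {c} > (1 - d) * card V"
    using gap[of "{c}"] by (auto simp: w_def)
  then show ?thesis using that[of c] by (simp add: w_def)
qed

section \<open>Renormalisation of site percolation\<close>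

text \<open>Links are recorded in one orientation only; the symmetric closure yields undirected
  components.\<close>

definition component :: "('v \<times> 'v) set \<Rightarrow> 'v \<Rightarrow> 'v set" where
  "component R v = (R \<union> R\<inverse>)\<^sup>* `` {v}"

lemma component_self: "v \<in> component R v"
  by (simp add: component_def)

lemma component_constant:
  assumes "\<And>a b. (a, b) \<in> R \<Longrightarrow> g a = g b" and "w \<in> component R v"
  shows "g w = g v"
proof -
  from assms(2) have "(v, w) \<in> (R \<union> R\<inverse>)\<^sup>*" by (simp add: component_def)
  then show ?thesis
    by (induction rule: rtrancl_induct) (auto dest: assms(1))
qed

lemma component_step:
  assumes "(u, v) \<in> R"
  shows "component R u = component R v"
proof -
  have "(u, v) \<in> (R \<union> R\<inverse>)\<^sup>*" "(v, u) \<in> (R \<union> R\<inverse>)\<^sup>*" using assms by auto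
  then show ?thesis by (auto simp: component_def intro: rtrancl_trans)
qed

definition next_to :: "nat \<times> nat \<Rightarrow> nat \<times> nat \<Rightarrow> bool" where
  "next_to s s' \<longleftrightarrow> s' = (Suc (fst s), snd s) \<or> s' = (fst s, Suc (snd s))"

abbreviation cells :: "(nat \<times> nat) set" where
  "cells \<equiv> {..<3} \<times> {..<3}"

definition subbox :: "nat \<times> nat \<Rightarrow> nat \<times> nat \<Rightarrow> nat \<times> nat" where
  "subbox z c = (3 * fst z + fst c, 3 * snd z + snd c)"

primrec box_good :: "(nat \<times> nat \<Rightarrow> bool) \<Rightarrow> nat \<Rightarrow> nat \<times> nat \<Rightarrow> bool" where
  "box_good G 0 z \<longleftrightarrow> G z"
| "box_good G (Suc k) z \<longleftrightarrow> card {c \<in> cells. \<not> box_good G k (subbox z c)} \<le> 1"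

text \<open>The choice is immaterial: all good subboxes of a good box carry the same label.\<close>

primrec box_label :: "(nat \<times> nat \<Rightarrow> bool) \<Rightarrow> (nat \<times> nat \<Rightarrow> 'l) \<Rightarrow> nat \<Rightarrow> nat \<times> nat \<Rightarrow> 'l" where
  "box_label G K 0 z = K z"
| "box_label G K (Suc k) z
    = box_label G K k (subbox z (SOME c. c \<in> cells \<and> box_good G k (subbox z c)))"

lemma box_good_Suc_iff:
  "box_good G (Suc k) z \<longleftrightarrow> (\<forall>c\<in>cells. \<forall>c'\<in>cells.
    \<not> box_good G k (subbox z c) \<longrightarrow> \<not> box_good G k (subbox z c') \<longrightarrow> c = c')"
proof -
  have "finite {c \<in> cells. \<not> box_good G k (subbox z c)}" by simp
  then show ?thesis
    by (subst box_good.simps, subst One_nat_def, subst card_le_Suc0_iff_eq) auto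
qed

text \<open>Some column \<open>a\<close> and some row \<open>b\<close> contain no bad cell. A good
  cell lies in a full column or a full row, since otherwise there would be two bad cells; along it
  and then along row \<open>b\<close> or column \<open>a\<close> the value agrees with
  \<open>f (a, b)\<close>.\<close>

lemma grid_minus_cell_connected:
  fixes f :: "nat \<times> nat \<Rightarrow> 'l"
  assumes one: "\<And>c c'. c \<in> cells \<Longrightarrow> c' \<in> cells \<Longrightarrow> \<not> P c \<Longrightarrow> \<not> P c' \<Longrightarrow> c = c'"
    and eq: "\<And>c c'. c \<in> cells \<Longrightarrow> c' \<in> cells \<Longrightarrow> P c \<Longrightarrow> P c' \<Longrightarrow> next_to c c' \<Longrightarrow> f c = f c'"
    and c: "c \<in> cells" "P c" and c': "c' \<in> cells" "P c'"
  shows "f c = f c'"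
proof -
  have h: "f (a, b) = f (Suc a, b)" if "a < 2" "b < 3" "P (a, b)" "P (Suc a, b)" for a b
    using that by (intro eq) (auto simp: next_to_def)
  have v: "f (a, b) = f (a, Suc b)" if "a < 3" "b < 2" "P (a, b)" "P (a, Suc b)" for a b
    using that by (intro eq) (auto simp: next_to_def)
  have less3: "n < 3 \<longleftrightarrow> n = 0 \<or> n = 1 \<or> n = 2" for n :: nat by auto
  define col where "col i \<longleftrightarrow> (\<forall>j<3. P (i, j))" for i
  define row where "row j \<longleftrightarrow> (\<forall>i<3. P (i, j))" for j
  have fcol: "f (i, j) = f (i, j')" if "col i" "i < 3" "j < 3" "j' < 3" for i j j'
  proof -
    have P: "P (i, k)" if "k < 3" for k using \<open>col i\<close> that by (simp add: col_def)
    have "f (i, 0) = f (i, Suc 0)" using v[of i 0] that P[of 0] P[of 1] by simp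
    moreover have "f (i, Suc 0) = f (i, 2)"
      using v[of i 1] that P[of 1] P[of 2] by (simp add: numeral_2_eq_2)
    ultimately have e: "f (i, k) = f (i, 0)" if "k < 3" for k
      using less3[THEN iffD1, OF that] by (elim disjE) simp_all
    show ?thesis using e[of j] e[of j'] that by (simp only:)
  qed
  have frow: "f (i, j) = f (i', j)" if "row j" "i < 3" "i' < 3" "j < 3" for i i' j
  proof -
    have P: "P (k, j)" if "k < 3" for k using \<open>row j\<close> that by (simp add: row_def)
    have "f (0, j) = f (Suc 0, j)" using h[of 0 j] that P[of 0] P[of 1] by simp
    moreover have "f (Suc 0, j) = f (2, j)"
      using h[of 1 j] that P[of 1] P[of 2] by (simp add: numeral_2_eq_2)
    ultimately have e: "f (k, j) = f (0, j)" if "k < 3" for k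
      using less3[THEN iffD1, OF that] by (elim disjE) simp_all
    show ?thesis using e[of i] e[of i'] that by (simp only:)
  qed
  have one': "i = i' \<and> j = j'" if "i < 3" "j < 3" "i' < 3" "j' < 3" "\<not> P (i, j)" "\<not> P (i', j')"
    for i j i' j'
    using one[of "(i, j)" "(i', j')"] that by simp
  obtain a where a: "a < 3" "col a"
  proof -
    have "col 0 \<or> col 1"
    proof (rule ccontr)
      assume "\<not> ?thesis"
      then obtain j j' where "j < 3" "\<not> P (0, j)" "j' < 3" "\<not> P (1, j')" by (auto simp: col_def)
      then show False using one'[of 0 j 1 j'] by simp
    qed
    then show ?thesis using that[of 0] that[of 1] by auto
  qed
  obtain b where b: "b < 3" "row b"
  proof -
    have "row 0 \<or> row 1"
    proof (rule ccontr)
      assume "\<not> ?thesis"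
      then obtain i i' where "i < 3" "\<not> P (i, 0)" "i' < 3" "\<not> P (i', 1)" by (auto simp: row_def)
      then show False using one'[of i 0 i' 1] by simp
    qed
    then show ?thesis using that[of 0] that[of 1] by auto
  qed
  have key: "f (i, j) = f (a, b)" if ij: "i < 3" "j < 3" "P (i, j)" for i j
  proof (cases "col i")
    case True
    then show ?thesis using fcol[of i j b] frow[of b i a] a b ij by simp
  next
    case False
    have "row j"
    proof (rule ccontr)
      assume "\<not> row j"
      with False obtain j1 i1 where "j1 < 3" "\<not> P (i, j1)" "i1 < 3" "\<not> P (i1, j)"
        by (auto simp: col_def row_def)
      then show False using one'[of i j1 i1 j] ij by auto
    qed
    then show ?thesis using frow[of j i a] fcol[of a j b] a b ij by simp
  qed
  have "f c = f (a, b)" using c by (cases c) (auto intro: key)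
  moreover have "f c' = f (a, b)" using c' by (cases c') (auto intro: key)
  ultimately show ?thesis by simp
qed

lemma subbox_next_to:
  assumes "next_to c c'"
  shows "next_to (subbox z c) (subbox z c')"
  using assms by (auto simp: next_to_def subbox_def)

text \<open>Consistency of neighbouring labels at level \<open>k\<close> is a hypothesis here, so
  that the lemma can serve inside the induction that establishes it.\<close>

lemma box_label_subbox_aux:
  assumes eq: "\<And>z z'. next_to z z' \<Longrightarrow> box_good G k z \<Longrightarrow> box_good G k z'
      \<Longrightarrow> box_label G K k z = box_label G K k z'"
    and good: "box_good G (Suc k) z" and c: "c \<in> cells" "box_good G k (subbox z c)"
  shows "box_label G K k (subbox z c) = box_label G K (Suc k) z"
proof -
  define c' where "c' = (SOME c. c \<in> cells \<and> box_good G k (subbox z c))"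
  have c': "c' \<in> cells \<and> box_good G k (subbox z c')"
    unfolding c'_def by (rule someI[of _ c]) (use c in blast)
  have "box_label G K k (subbox z c) = box_label G K k (subbox z c')"
  proof (rule grid_minus_cell_connected[where P = "\<lambda>c. box_good G k (subbox z c)"
          and f = "\<lambda>c. box_label G K k (subbox z c)"])
    fix d d' assume "d \<in> cells" "d' \<in> cells" "\<not> box_good G k (subbox z d)" "\<not> box_good G k (subbox z d')"
    then show "d = d'" using good[unfolded box_good_Suc_iff] by (blast dest: bspec)
  next
    fix d d' assume "box_good G k (subbox z d)" "box_good G k (subbox z d')" "next_to d d'"
    then show "box_label G K k (subbox z d) = box_label G K k (subbox z d')"
      by (intro eq subbox_next_to)
  qed (use c c' in simp_all)
  then show ?thesis by (simp add: c'_def)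
qed

text \<open>Three pairs of subboxes face each other across the common side. Each box spoils at most
  one pair, so some pair is good on both sides and the induction hypothesis transfers the
  label.\<close>

lemma box_label_next_to:
  assumes K: "\<And>s s'. next_to s s' \<Longrightarrow> G s \<Longrightarrow> G s' \<Longrightarrow> K s = K s'"
  shows "next_to z z' \<Longrightarrow> box_good G k z \<Longrightarrow> box_good G k z'
    \<Longrightarrow> box_label G K k z = box_label G K k z'"
proof (induction k arbitrary: z z')
  case 0
  then show ?case using K by simp
next
  case (Suc k)
  have "\<exists>c\<in>cells. \<exists>c'\<in>cells. next_to (subbox z c) (subbox z' c')
      \<and> box_good G k (subbox z c) \<and> box_good G k (subbox z' c')"
  proof -
    \<comment> \<open>The facing cells: right column against left column, or upper row against lower
      row.\<close>
    define e e' where "e t = (if snd z' = snd z then (2, t) else (t, 2))"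
      and "e' t = (if snd z' = snd z then (0, t) else (t, 0))" for t :: nat
    have *: "e t \<in> cells" "e' t \<in> cells" "next_to (subbox z (e t)) (subbox z' (e' t))"
      if "t < 3" for t
      using that Suc.prems(1) by (auto simp: e_def e'_def next_to_def subbox_def)
    have inj: "e t = e t' \<longleftrightarrow> t = t'" "e' t = e' t' \<longleftrightarrow> t = t'" for t t'
      by (auto simp: e_def e'_def)
    define Q where "Q t \<longleftrightarrow> box_good G k (subbox z (e t))" for t
    define Q' where "Q' t \<longleftrightarrow> box_good G k (subbox z' (e' t))" for t
    have Q: "t = t'" if "t < 3" "t' < 3" "\<not> Q t" "\<not> Q t'" for t t'
      using Suc.prems(2)[unfolded box_good_Suc_iff, rule_format, of "e t" "e t'"]
        *[of t] *[of t'] that inj by (simp add: Q_def)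
    have Q': "t = t'" if "t < 3" "t' < 3" "\<not> Q' t" "\<not> Q' t'" for t t'
      using Suc.prems(3)[unfolded box_good_Suc_iff, rule_format, of "e' t" "e' t'"]
        *[of t] *[of t'] that inj by (simp add: Q'_def)
    have "Q 0 \<or> Q 1" "Q 0 \<or> Q 2" "Q 1 \<or> Q 2" "Q' 0 \<or> Q' 1" "Q' 0 \<or> Q' 2" "Q' 1 \<or> Q' 2"
      using Q[of 0 1] Q[of 0 2] Q[of 1 2] Q'[of 0 1] Q'[of 0 2] Q'[of 1 2] by auto
    then have "Q 0 \<and> Q' 0 \<or> Q 1 \<and> Q' 1 \<or> Q 2 \<and> Q' 2" by blast
    moreover have "(0::nat) < 3" "(1::nat) < 3" "(2::nat) < 3" by simp_all
    ultimately have "\<exists>t<3. Q t \<and> Q' t" by blast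
    then show ?thesis using * unfolding Q_def Q'_def by blast
  qed
  then obtain c c' where c: "c \<in> cells" "c' \<in> cells" "next_to (subbox z c) (subbox z' c')"
      "box_good G k (subbox z c)" "box_good G k (subbox z' c')" by blast
  have "box_label G K (Suc k) z = box_label G K k (subbox z c)"
    by (rule box_label_subbox_aux[OF _ Suc.prems(2) c(1,4), symmetric]) (rule Suc.IH)
  also have "\<dots> = box_label G K k (subbox z' c')"
    using c by (intro Suc.IH)
  also have "\<dots> = box_label G K (Suc k) z'"
    by (rule box_label_subbox_aux[OF _ Suc.prems(3) c(2,5)]) (rule Suc.IH)
  finally show ?case .
qed

lemma box_label_subbox:
  assumes "\<And>s s'. next_to s s' \<Longrightarrow> G s \<Longrightarrow> G s' \<Longrightarrow> K s = K s'"
    and "box_good G (Suc k) z" "c \<in> cells" "box_good G k (subbox z c)"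
  shows "box_label G K k (subbox z c) = box_label G K (Suc k) z"
proof (rule box_label_subbox_aux[OF _ assms(2-)])
  fix z z' assume "next_to z z'" "box_good G k z" "box_good G k z'"
  then show "box_label G K k z = box_label G K k z'"
    using assms(1) by (intro box_label_next_to) auto
qed

definition in_box :: "nat \<Rightarrow> nat \<times> nat \<Rightarrow> nat \<times> nat \<Rightarrow> bool" where
  "in_box k z s \<longleftrightarrow> fst s div 3 ^ k = fst z \<and> snd s div 3 ^ k = snd z"

lemma in_box_0: "in_box 0 z s \<longleftrightarrow> s = z"
  by (auto simp: in_box_def prod_eq_iff)

lemma in_box_Suc:
  assumes "c \<in> cells" "in_box k (subbox z c) s"
  shows "in_box (Suc k) z s"
proof -
  have "n div 3 ^ Suc k = (n div 3 ^ k) div 3" for n :: nat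
    by (simp only: power_Suc2 div_mult2_eq)
  then show ?thesis using assms by (auto simp: in_box_def subbox_def)
qed

text \<open>The cells \<open>(0, 0)\<close> and \<open>(1, 1)\<close> cannot both be bad, so one can
  descend through good subboxes, all with the same label, down to a site.\<close>

lemma box_good_site:
  assumes K: "\<And>s s'. next_to s s' \<Longrightarrow> G s \<Longrightarrow> G s' \<Longrightarrow> K s = K s'"
  shows "box_good G k z \<Longrightarrow> \<exists>s. in_box k z s \<and> G s \<and> K s = box_label G K k z"
proof (induction k arbitrary: z)
  case 0
  then show ?case by (auto simp: in_box_0)
next
  case (Suc k)
  have "\<exists>c\<in>cells. box_good G k (subbox z c)"
  proof (rule ccontr)
    assume "\<not> ?thesis"
    moreover have "(0, 0) \<in> cells" "(1, 1) \<in> cells" by auto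
    ultimately have "(0::nat, 0::nat) = (1, 1)"
      using Suc.prems[unfolded box_good_Suc_iff] by blast
    then show False by simp
  qed
  then obtain c where c: "c \<in> cells" "box_good G k (subbox z c)" by blast
  then obtain s where "in_box k (subbox z c) s" "G s" "K s = box_label G K k (subbox z c)"
    using Suc.IH by blast
  moreover have "box_label G K k (subbox z c) = box_label G K (Suc k) z"
    by (rule box_label_subbox[where K = K, OF K Suc.prems c])
  ultimately show ?case using in_box_Suc[OF c(1)] by metis
qed

text \<open>The boxes at the corner are nested and share the label \<open>K (0, 0)\<close>. At every
  scale a subbox away from the corner is good and supplies a site of this label with coordinate sum
  at least \<open>3 ^ k\<close>.\<close>

lemma infinite_good_sites:
  assumes K: "\<And>s s'. next_to s s' \<Longrightarrow> G s \<Longrightarrow> G s' \<Longrightarrow> K s = K s'"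
    and good: "\<And>k. box_good G k (0, 0)"
  shows "infinite {s. G s \<and> K s = K (0, 0)}"
proof
  assume fin: "finite {s. G s \<and> K s = K (0, 0)}"
  have sub0: "subbox (0, 0) c = c" for c by (simp add: subbox_def)
  have lab: "box_label G K k (0, 0) = K (0, 0)" for k
  proof (induction k)
    case (Suc k)
    then show ?case
      using box_label_subbox[where K = K, OF K good[of "Suc k"], where c = "(0, 0)"] good[of k] by (simp add: sub0)
  qed simp
  have "\<exists>s. G s \<and> K s = K (0, 0) \<and> 3 ^ k \<le> fst s + snd s" for k
  proof -
    have "\<exists>c\<in>cells. c \<noteq> (0, 0) \<and> box_good G k c"
    proof (rule ccontr)
      assume "\<not> ?thesis"
      moreover have mem: "(0, 1) \<in> cells" "(1, 0) \<in> cells" by auto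
      moreover have "(0::nat, 1::nat) \<noteq> (0, 0)" "(1::nat, 0::nat) \<noteq> (0, 0)" by auto
      ultimately have "\<not> box_good G k (0, 1)" "\<not> box_good G k (1, 0)" by blast+
      with mem have "(0::nat, 1::nat) = (1, 0)"
        using good[of "Suc k", unfolded box_good_Suc_iff] unfolding sub0 by blast
      then show False by simp
    qed
    then obtain c where c: "c \<in> cells" "c \<noteq> (0, 0)" "box_good G k c" by blast
    obtain s where s: "in_box k c s" "G s" "K s = box_label G K k c"
      using box_good_site[where K = K, OF K c(3)] by blast
    have "box_label G K k c = box_label G K (Suc k) (0, 0)"
      using box_label_subbox[where K = K, OF K good[of "Suc k"] c(1)] c(3) by (simp add: sub0)
    have Ks: "K s = K (0, 0)" using \<open>box_label G K k c = _\<close> s(3) lab by (simp only:)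
    have "3 ^ k \<le> fst s \<or> 3 ^ k \<le> snd s"
    proof (rule ccontr)
      assume "\<not> ?thesis"
      then have "fst c = 0 \<and> snd c = 0" using s(1) by (auto simp: in_box_def not_le)
      then show False using c(2) by (simp add: prod_eq_iff)
    qed
    then have "3 ^ k \<le> fst s + snd s" by linarith
    then show ?thesis using s(2) Ks by blast
  qed
  \<comment> \<open>Finiteness would bound the coordinate sums by some \<open>B\<close>; the scale
    \<open>k = B\<close> contradicts this.\<close>
  moreover obtain B where B: "\<And>n. n \<in> (\<lambda>s. fst s + snd s) ` {s. G s \<and> K s = K (0, 0)} \<Longrightarrow> n \<le> B"
    using finite_imageI[OF fin, of "\<lambda>s. fst s + snd s"]
    unfolding finite_nat_set_iff_bounded_le by blast
  ultimately obtain s where "G s" "K s = K (0, 0)" "3 ^ B \<le> fst s + snd s" by blast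
  then have "3 ^ B \<le> B" using B[of "fst s + snd s"] by auto
  moreover have "B < 3 ^ B" by (induction B) auto
  ultimately show False by simp
qed

section \<open>Hypercubes attached to sites\<close>

text \<open>A site carries a copy of the hypercube \<open>Pow {..<m}\<close>. The links in the directions \<open>b < m\<close> stay
  inside the copy, those in the directions \<open>m\<close> and \<open>Suc m\<close> lead to the two next sites.\<close>

definition link_target :: "nat \<Rightarrow> nat \<times> nat \<Rightarrow> nat set \<Rightarrow> nat \<Rightarrow> (nat \<times> nat) \<times> nat set" where
  "link_target m s h b = (if b < m then (s, insert b h)
     else if b = m then ((Suc (fst s), snd s), h) else ((fst s, Suc (snd s)), h))"

definition link_set :: "nat \<Rightarrow> ((nat \<times> nat) \<times> nat set \<times> nat) set" where
  "link_set m = {(s, h, b). h \<subseteq> {..<m} \<and> b \<le> Suc m \<and> b \<notin> h}"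

definition open_links ::
  "nat \<Rightarrow> ((nat \<times> nat) \<times> nat set \<times> nat \<Rightarrow> bool) \<Rightarrow> (((nat \<times> nat) \<times> nat set) \<times> ((nat \<times> nat) \<times> nat set)) set"
  where "open_links m x = {((s, h), link_target m s h b) | s h b. (s, h, b) \<in> link_set m \<and> x (s, h, b)}"

lemma open_linksI:
  "(s, h, b) \<in> link_set m \<Longrightarrow> x (s, h, b) \<Longrightarrow> ((s, h), link_target m s h b) \<in> open_links m x"
  unfolding open_links_def by blast

text \<open>The first clause forces a component containing almost the whole copy of the hypercube, the second
  clause makes the large components of adjacent good sites meet. Both refer only to the links that
  start at \<open>s\<close>, so distinct sites are independent.\<close>

definition site_good ::
  "real \<Rightarrow> nat \<Rightarrow> ((nat \<times> nat) \<times> nat set \<times> nat \<Rightarrow> bool) \<Rightarrow> nat \<times> nat \<Rightarrow> bool" where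
  "site_good d m x s \<longleftrightarrow>
    (\<forall>A. A \<subseteq> Pow {..<m} \<and> d * 2 ^ m \<le> real (card A) \<and> real (card A) \<le> (1 - d) * 2 ^ m \<longrightarrow>
      (\<exists>(h, b)\<in>cube_cut {..<m} {..<m} A. x (s, h, b))) \<and>
    (\<forall>b\<in>{m, Suc m}. \<forall>S. S \<subseteq> Pow {..<m} \<and> (1 - 2 * d) * 2 ^ m \<le> real (card S) \<longrightarrow>
      (\<exists>h\<in>S. x (s, h, b)))"

text \<open>The label is the giant component itself, taken in the whole link graph and not only in
  the copy at \<open>s\<close>, so equal labels mean connected copies. It is meaningful only if such
  a component exists.\<close>

definition site_label ::
  "real \<Rightarrow> nat \<Rightarrow> ((nat \<times> nat) \<times> nat set \<times> nat \<Rightarrow> bool) \<Rightarrow> nat \<times> nat \<Rightarrow> ((nat \<times> nat) \<times> nat set) set"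
  where "site_label d m x s = (SOME c.
    real (card {h \<in> Pow {..<m}. component (open_links m x) (s, h) = c}) > (1 - d) * 2 ^ m)"

text \<open>If a union of components met the copy in a set of intermediate size, the first clause of
  \<open>site_good\<close> would give an open link in its cut, although the endpoints of an open
  link share a component.\<close>

lemma site_good_label:
  fixes d :: real
  assumes good: "site_good d m x s" and d: "0 < d" "d \<le> 1 / 3"
  shows "real (card {h \<in> Pow {..<m}. component (open_links m x) (s, h) = site_label d m x s})
    > (1 - d) * 2 ^ m"
proof -
  let ?f = "\<lambda>h. component (open_links m x) (s, h)"
  have N: "real (card (Pow {..<m})) = 2 ^ m" by (simp add: card_Pow)
  obtain c where "card {h \<in> Pow {..<m}. ?f h = c} > (1 - d) * card (Pow {..<m})"
  proof (rule large_fibre[of "Pow {..<m}" d ?f])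
    fix L
    let ?A = "{h \<in> Pow {..<m}. ?f h \<in> L}"
    show "\<not> (d * real (card (Pow {..<m})) \<le> real (card ?A) \<and> real (card ?A) \<le> (1 - d) * real (card (Pow {..<m})))"
    proof
      assume "d * real (card (Pow {..<m})) \<le> real (card ?A) \<and> real (card ?A) \<le> (1 - d) * real (card (Pow {..<m}))"
      then have "?A \<subseteq> Pow {..<m} \<and> d * 2 ^ m \<le> real (card ?A) \<and> real (card ?A) \<le> (1 - d) * 2 ^ m"
        by (simp only: N) auto
      then obtain h b where hb: "(h, b) \<in> cube_cut {..<m} {..<m} ?A" "x (s, h, b)"
        using good unfolding site_good_def by blast
      then have sub: "h \<subseteq> {..<m}" "b < m" "b \<notin> h" and diff: "(h \<in> ?A) \<noteq> (insert b h \<in> ?A)"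
        by (auto simp: cube_cut_def)
      then have "((s, h), (s, insert b h)) \<in> open_links m x"
        using open_linksI[of s h b m x] hb(2) by (simp add: link_target_def link_set_def)
      then have "?f h = ?f (insert b h)" by (rule component_step)
      then show False using diff sub by auto
    qed
  qed (use d in auto)
  then have "card {h \<in> Pow {..<m}. ?f h = c} > (1 - d) * 2 ^ m" unfolding N .
  then show ?thesis unfolding site_label_def by (rule someI)
qed

text \<open>The giant parts of the two copies have more than \<open>(1 - d) * 2 ^ m\<close> vertices
  each, hence at least \<open>(1 - 2 * d) * 2 ^ m\<close> positions \<open>h\<close> in common. The
  second clause at \<open>s\<close> opens a link over one of them.\<close>

lemma site_label_next_to:
  fixes d :: real
  assumes d: "0 < d" "d \<le> 1 / 3" and "next_to s s'"
    and good: "site_good d m x s" "site_good d m x s'"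
  shows "site_label d m x s = site_label d m x s'"
proof -
  define S where "S t = {h \<in> Pow {..<m}. component (open_links m x) (t, h) = site_label d m x t}" for t
  have fin: "finite (S t)" for t by (simp add: S_def)
  have "real (card (S s)) > (1 - d) * 2 ^ m" "real (card (S s')) > (1 - d) * 2 ^ m"
    unfolding S_def by (rule site_good_label[OF _ d], fact)+
  moreover have "real (card (S s)) + real (card (S s')) = real (card (S s \<union> S s')) + real (card (S s \<inter> S s'))"
    unfolding of_nat_add[symmetric] by (subst card_Un_Int[OF fin fin]) simp
  moreover have "card (S s \<union> S s') \<le> card (Pow {..<m})"
    by (rule card_mono) (auto simp: S_def)
  then have "real (card (S s \<union> S s')) \<le> real (card (Pow {..<m}))" by (rule of_nat_mono)
  moreover have "real (card (Pow {..<m})) = 2 ^ m" by (simp add: card_Pow)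
  moreover have "(1 - 2 * d) * 2 ^ m = (1 - d) * 2 ^ m + (1 - d) * 2 ^ m - 2 ^ m"
    by (simp add: algebra_simps)
  ultimately have large: "(1 - 2 * d) * 2 ^ m \<le> real (card (S s \<inter> S s'))"
    by linarith
  obtain b where b: "b \<in> {m, Suc m}" "\<And>h. link_target m s h b = (s', h)"
  proof (cases "snd s' = snd s")
    case True
    then show ?thesis using that[of m] \<open>next_to s s'\<close> by (auto simp: next_to_def link_target_def)
  next
    case False
    then show ?thesis using that[of "Suc m"] \<open>next_to s s'\<close> by (auto simp: next_to_def link_target_def)
  qed
  have "S s \<inter> S s' \<subseteq> Pow {..<m}" by (auto simp: S_def)
  then obtain h where h: "h \<in> S s \<inter> S s'" "x (s, h, b)"
    using good(1) b(1) large unfolding site_good_def by blast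
  have "h \<subseteq> {..<m}" using h by (simp add: S_def)
  then have "(s, h, b) \<in> link_set m" using b(1) by (auto simp: link_set_def)
  then have "((s, h), (s', h)) \<in> open_links m x"
    using open_linksI[of s h b m x] h(2) b(2) by simp
  then have "component (open_links m x) (s, h) = component (open_links m x) (s', h)"
    by (rule component_step)
  moreover have "component (open_links m x) (s, h) = site_label d m x s"
    "component (open_links m x) (s', h) = site_label d m x s'"
    using h by (auto simp: S_def)
  ultimately show ?thesis by simp
qed

text \<open>Infinitely many good sites share the label of \<open>(0, 0)\<close>, and each adds a
  vertex to that component. Starting in the copy at \<open>(0, 0)\<close> leaves only
  \<open>2 ^ m\<close> candidates for a later union bound.\<close>

lemma infinite_component_links:
  fixes d :: real
  assumes d: "0 < d" "d \<le> 1 / 3"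
    and good: "\<And>k. box_good (site_good d m x) k (0, 0)"
  shows "\<exists>h\<subseteq>{..<m}. infinite (component (open_links m x) ((0, 0), h))"
proof -
  let ?K = "site_label d m x" and ?C = "component (open_links m x)"
  have inf: "infinite {s. site_good d m x s \<and> ?K s = ?K (0, 0)}"
  proof (rule infinite_good_sites)
    show "?K s = ?K s'" if "next_to s s'" "site_good d m x s" "site_good d m x s'" for s s'
      using site_label_next_to d that by blast
  qed (rule good)
  have ex: "\<exists>h\<subseteq>{..<m}. ?C (s, h) = ?K s" if "site_good d m x s" for s
  proof (rule ccontr)
    assume "\<not> ?thesis"
    then have e: "{h \<in> Pow {..<m}. ?C (s, h) = ?K s} = {}" by blast
    have "(0::real) \<le> (1 - d) * 2 ^ m" using d by simp
    then show False using site_good_label[OF that d] unfolding e by simp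
  qed
  have "site_good d m x (0, 0)" using good[of 0] by simp
  then obtain h0 where h0: "h0 \<subseteq> {..<m}" "?C ((0, 0), h0) = ?K (0, 0)" using ex by blast
  have "{s. site_good d m x s \<and> ?K s = ?K (0, 0)} \<subseteq> fst ` ?C ((0, 0), h0)"
  proof
    fix s assume "s \<in> {s. site_good d m x s \<and> ?K s = ?K (0, 0)}"
    then have s: "site_good d m x s" "?K s = ?K (0, 0)" by auto
    then obtain h where "?C (s, h) = ?K s" using ex by blast
    then have "(s, h) \<in> ?C ((0, 0), h0)" using s h0 component_self by metis
    then show "s \<in> fst ` ?C ((0, 0), h0)" by (metis fst_conv imageI)
  qed
  then have "infinite (?C ((0, 0), h0))" using inf finite_subset finite_imageI by blast
  then show ?thesis using h0(1) by blast
qed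

section \<open>Probability of bad boxes\<close>

text \<open>A pointwise form of measurability with respect to the coordinates in \<open>D\<close>:
  for finite \<open>D\<close> it yields events, and for disjoint finite sets independent
  ones.\<close>

definition determined_by :: "'i set \<Rightarrow> (('i \<Rightarrow> bool) \<Rightarrow> bool) \<Rightarrow> bool" where
  "determined_by D P \<longleftrightarrow> (\<forall>x x'. (\<forall>i\<in>D. x i = x' i) \<longrightarrow> P x = P x')"

lemma determined_byD:
  "determined_by D P \<Longrightarrow> (\<And>i. i \<in> D \<Longrightarrow> x i = x' i) \<Longrightarrow> P x = P x'"
  unfolding determined_by_def by blast

lemma determined_by_restrict: "determined_by D P \<Longrightarrow> P (restrict x D) = P x"
  by (erule determined_byD) simp

text \<open>A uniform upper bound \<open>y\<close> on the closing probabilities, because links of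
  different lengths have different probabilities.\<close>

locale bond_family = prob_space M for M :: "'a measure" +
  fixes X :: "'i \<Rightarrow> 'a \<Rightarrow> bool" and I :: "'i set" and y :: real
  assumes indep: "indep_vars (\<lambda>_. count_space UNIV) X I"
    and closed_prob: "\<And>i. i \<in> I \<Longrightarrow> prob {\<omega> \<in> space M. \<not> X i \<omega>} \<le> y"
begin

lemma PiM_bool_eq:
  "finite D \<Longrightarrow> PiM D (\<lambda>_. count_space (UNIV :: bool set)) = count_space (PiE D (\<lambda>_. UNIV))"
  by (intro count_space_PiM_finite) auto

lemma determined_event_eq:
  assumes "determined_by D P"
  shows "{\<omega> \<in> space M. P (\<lambda>i. X i \<omega>)}
    = (\<lambda>\<omega>. restrict (\<lambda>i. X i \<omega>) D) -` {x \<in> PiE D (\<lambda>_. UNIV). P x} \<inter> space M"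
  using determined_by_restrict[OF assms] by auto

lemma determined_event:
  assumes "finite D" "D \<subseteq> I" "determined_by D P"
  shows "{\<omega> \<in> space M. P (\<lambda>i. X i \<omega>)} \<in> events"
proof -
  have "(\<lambda>\<omega>. restrict (\<lambda>i. X i \<omega>) D) \<in> measurable M (PiM D (\<lambda>_. count_space UNIV))"
    using indep assms(2) by (intro measurable_restrict) (auto simp: indep_vars_def)
  then show ?thesis
    unfolding determined_event_eq[OF assms(3)] PiM_bool_eq[OF assms(1)]
    by (rule measurable_sets) auto
qed

lemma prob_disjoint_determined:
  assumes D: "finite D" "D \<subseteq> I" "determined_by D P"
    and D': "finite D'" "D' \<subseteq> I" "determined_by D' P'" and "D \<inter> D' = {}"
  shows "prob ({\<omega> \<in> space M. P (\<lambda>i. X i \<omega>)} \<inter> {\<omega> \<in> space M. P' (\<lambda>i. X i \<omega>)})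
    = prob {\<omega> \<in> space M. P (\<lambda>i. X i \<omega>)} * prob {\<omega> \<in> space M. P' (\<lambda>i. X i \<omega>)}"
proof -
  have "indep_var (count_space (PiE D (\<lambda>_. UNIV))) (\<lambda>\<omega>. restrict (\<lambda>i. X i \<omega>) D)
      (count_space (PiE D' (\<lambda>_. UNIV))) (\<lambda>\<omega>. restrict (\<lambda>i. X i \<omega>) D')"
    using indep_var_restrict[OF indep assms(7) D(2) D'(2)] D(1) D'(1) by (simp add: PiM_bool_eq)
  from indep_varD[OF this, of "{x \<in> PiE D (\<lambda>_. UNIV). P x}" "{x \<in> PiE D' (\<lambda>_. UNIV). P' x}"]
  show ?thesis
    unfolding determined_event_eq[OF D(3)] determined_event_eq[OF D'(3)]
    by (simp add: vimage_def Int_def conj_ac cong: conj_cong)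
      (simp add: conj_ac Collect_conj_eq)
qed

lemma prob_all_closed:
  assumes "finite F" "F \<subseteq> I"
  shows "prob {\<omega> \<in> space M. \<forall>i\<in>F. \<not> X i \<omega>} \<le> y ^ card F"
proof (cases "F = {}")
  case False
  have eq: "X i -` {False} \<inter> space M = {\<omega> \<in> space M. \<not> X i \<omega>}" for i by auto
  have "{\<omega> \<in> space M. \<forall>i\<in>F. \<not> X i \<omega>} = (\<Inter>i\<in>F. X i -` {False} \<inter> space M)"
    using False by auto
  then have "prob {\<omega> \<in> space M. \<forall>i\<in>F. \<not> X i \<omega>} = (\<Prod>i\<in>F. prob {\<omega> \<in> space M. \<not> X i \<omega>})"
    using indep_varsD[OF indep False assms, of "\<lambda>_. {False}"] by (simp add: eq)
  also have "\<dots> \<le> (\<Prod>i\<in>F. y)"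
    using assms closed_prob by (intro prod_mono) auto
  finally show ?thesis by simp
qed (use prob_le_1 in simp)

lemma closed_event:
  assumes "finite F" "F \<subseteq> I"
  shows "{\<omega> \<in> space M. \<forall>i\<in>F. \<not> X i \<omega>} \<in> events"
  using determined_event[of F "\<lambda>x. \<forall>i\<in>F. \<not> x i"] assms by (auto simp: determined_by_def)

end

definition site_links :: "nat \<Rightarrow> nat \<times> nat \<Rightarrow> ((nat \<times> nat) \<times> nat set \<times> nat) set" where
  "site_links m s = {(t, h, b) \<in> link_set m. t = s}"

definition box_links :: "nat \<Rightarrow> nat \<Rightarrow> nat \<times> nat \<Rightarrow> ((nat \<times> nat) \<times> nat set \<times> nat) set" where
  "box_links m k z = {(t, h, b) \<in> link_set m. in_box k z t}"

lemma determined_site_good: "determined_by (site_links m s) (\<lambda>x. site_good d m x s)"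
  unfolding determined_by_def
proof (intro allI impI)
  fix x x' :: "(nat \<times> nat) \<times> nat set \<times> nat \<Rightarrow> bool"
  assume eq: "\<forall>i\<in>site_links m s. x i = x' i"
  have "x (s, h, b) = x' (s, h, b)" if "h \<in> Pow {..<m}" "b \<in> {m, Suc m}" for h b
  proof (rule eq[rule_format])
    show "(s, h, b) \<in> site_links m s" using that by (auto simp: site_links_def link_set_def)
  qed
  then have l: "(\<exists>h\<in>S. x (s, h, b)) = (\<exists>h\<in>S. x' (s, h, b))"
    if "S \<subseteq> Pow {..<m}" "b \<in> {m, Suc m}" for S b
    using that by blast
  have "x (s, h, b) = x' (s, h, b)" if "(h, b) \<in> cube_cut {..<m} {..<m} A" for h b A
    using eq[rule_format, of "(s, h, b)"] that
    by (auto simp: site_links_def link_set_def cube_cut_def)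
  then have c: "(\<exists>(h, b)\<in>cube_cut {..<m} {..<m} A. x (s, h, b))
      = (\<exists>(h, b)\<in>cube_cut {..<m} {..<m} A. x' (s, h, b))" for A
    by blast
  show "site_good d m x s = site_good d m x' s"
    unfolding site_good_def c
    by (rule arg_cong2[where f = "(\<and>)"], rule refl, intro ball_cong refl all_cong1 imp_cong l) auto
qed

lemma determined_box_good:
  "determined_by (box_links m k z) (\<lambda>x. box_good (site_good d m x) k z)"
proof (induction k arbitrary: z)
  case 0
  have "box_links m 0 z = site_links m z" by (auto simp: box_links_def site_links_def in_box_0)
  then show ?case using determined_site_good by simp
next
  case (Suc k)
  show ?case
    unfolding determined_by_def
  proof (intro allI impI)
    fix x x' :: "(nat \<times> nat) \<times> nat set \<times> nat \<Rightarrow> bool"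
    assume eq: "\<forall>i\<in>box_links m (Suc k) z. x i = x' i"
    have "box_good (site_good d m x) k (subbox z c) = box_good (site_good d m x') k (subbox z c)"
      if c: "c \<in> cells" for c
    proof (rule determined_byD[OF Suc.IH])
      fix i assume "i \<in> box_links m k (subbox z c)"
      then have "i \<in> box_links m (Suc k) z" using in_box_Suc[OF c, of k z] by (auto simp: box_links_def)
      then show "x i = x' i" using eq by blast
    qed
    then have "{c \<in> cells. \<not> box_good (site_good d m x) k (subbox z c)}
        = {c \<in> cells. \<not> box_good (site_good d m x') k (subbox z c)}" by blast
    then show "box_good (site_good d m x) (Suc k) z = box_good (site_good d m x') (Suc k) z"
      by (simp only: box_good.simps)
  qed
qed

lemma finite_box_links: "finite (box_links m k z)"
proof -
  have lt: "n < 3 ^ k * Suc (n div 3 ^ k)" for n :: nat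
    using dividend_less_div_times[of "3 ^ k" n] by (simp add: algebra_simps)
  have "fst t < 3 ^ k * Suc (fst z)" "snd t < 3 ^ k * Suc (snd z)" if "in_box k z t" for t
    using that lt[of "fst t"] lt[of "snd t"] by (simp_all add: in_box_def)
  then have "box_links m k z
      \<subseteq> ({..<3 ^ k * Suc (fst z)} \<times> {..<3 ^ k * Suc (snd z)}) \<times> (Pow {..<m} \<times> {..Suc m})"
    by (force simp: box_links_def link_set_def)
  then show ?thesis by (rule finite_subset) simp
qed

lemma box_links_disjoint: "z \<noteq> z' \<Longrightarrow> box_links m k z \<inter> box_links m k z' = {}"
  by (auto simp: box_links_def in_box_def prod_eq_iff)

locale site_bonds = bond_family M X "link_set m" y for M :: "'a measure" and X m y +
  fixes d :: real
begin

abbreviation bad_box :: "nat \<Rightarrow> nat \<times> nat \<Rightarrow> 'a set" where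
  "bad_box k z \<equiv> {\<omega> \<in> space M. \<not> box_good (site_good d m (\<lambda>i. X i \<omega>)) k z}"

lemma determined_bad:
  "determined_by (box_links m k z) (\<lambda>x. \<not> box_good (site_good d m x) k z)"
  using determined_box_good unfolding determined_by_def by blast

lemma box_links_subset: "box_links m k z \<subseteq> link_set m"
  by (auto simp: box_links_def)

lemma bad_box_event: "bad_box k z \<in> events"
  by (rule determined_event[OF finite_box_links box_links_subset determined_bad])

lemma prob_bad_boxes:
  "z \<noteq> z' \<Longrightarrow> prob (bad_box k z \<inter> bad_box k z') = prob (bad_box k z) * prob (bad_box k z')"
  by (rule prob_disjoint_determined[OF finite_box_links box_links_subset determined_bad
        finite_box_links box_links_subset determined_bad box_links_disjoint])

text \<open>A bad site has a completely closed cut of a set of intermediate size, or a large set of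
  closed links in one of the two outgoing directions. Each of these three failures has probability
  at most \<open>\<eta>\<close> by a union bound.\<close>

lemma prob_bad_site_le:
  assumes "(\<Sum>A | A \<subseteq> Pow {..<m} \<and> d * 2 ^ m \<le> card A \<and> card A \<le> (1 - d) * 2 ^ m.
        y ^ card (cube_cut {..<m} {..<m} A)) \<le> \<eta>"
    "(\<Sum>S | S \<subseteq> Pow {..<m} \<and> (1 - 2 * d) * 2 ^ m \<le> card S. y ^ card S) \<le> \<eta>"
  shows "prob (bad_box 0 s) \<le> 3 * \<eta>"
proof -
  let ?\<A> = "{A. A \<subseteq> Pow {..<m} \<and> d * 2 ^ m \<le> card A \<and> card A \<le> (1 - d) * 2 ^ m}"
  let ?\<S> = "{S. S \<subseteq> Pow {..<m} \<and> (1 - 2 * d) * 2 ^ m \<le> card S}"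
  define FA where "FA A = (\<lambda>(h, b). (s, h, b)) ` cube_cut {..<m} {..<m} A" for A
  define FS where "FS b S = (\<lambda>h. (s, h, b)) ` S" for b :: nat and S :: "nat set set"
  define C where "C F = {\<omega> \<in> space M. \<forall>i\<in>F. \<not> X i \<omega>}" for F
  have fin: "finite ?\<A>" "finite ?\<S>"
    by (rule finite_subset[of _ "Pow (Pow {..<m})"]; auto)+
  have FA: "finite (FA A)" "FA A \<subseteq> link_set m" "card (FA A) = card (cube_cut {..<m} {..<m} A)" for A
  proof -
    show "finite (FA A)" by (simp add: FA_def finite_cube_cut)
    show "FA A \<subseteq> link_set m" by (auto simp: FA_def cube_cut_def link_set_def)
    show "card (FA A) = card (cube_cut {..<m} {..<m} A)"
      unfolding FA_def by (rule card_image) (auto simp: inj_on_def)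
  qed
  have FS: "finite (FS b S)" "FS b S \<subseteq> link_set m" "card (FS b S) = card S"
    if S: "S \<in> ?\<S>" and b: "b \<in> {m, Suc m}" for b S
  proof -
    show "finite (FS b S)" using S finite_subset[of S "Pow {..<m}"] by (auto simp: FS_def)
    show "FS b S \<subseteq> link_set m" using S b by (fastforce simp: FS_def link_set_def)
    show "card (FS b S) = card S" unfolding FS_def by (rule card_image) (auto simp: inj_on_def)
  qed
  have ev: "C (FA A) \<in> events" for A
    unfolding C_def using FA by (intro closed_event)
  have ev': "C (FS b S) \<in> events" if "S \<in> ?\<S>" "b \<in> {m, Suc m}" for b S
    unfolding C_def using FS[OF that] by (intro closed_event)
  define U where "U = (\<Union>A\<in>?\<A>. C (FA A))"
  define V where "V b = (\<Union>S\<in>?\<S>. C (FS b S))" for b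
  have U: "U \<in> events" unfolding U_def using fin ev by (intro sets.finite_UN) auto
  have V: "V b \<in> events" if "b \<in> {m, Suc m}" for b
    unfolding V_def using fin ev' that by (intro sets.finite_UN) auto
  have "bad_box 0 s \<subseteq> U \<union> (V m \<union> V (Suc m))"
  proof
    fix \<omega> assume w: "\<omega> \<in> bad_box 0 s"
    then have "(\<exists>A\<in>?\<A>. \<forall>(h, b)\<in>cube_cut {..<m} {..<m} A. \<not> X (s, h, b) \<omega>)
        \<or> (\<exists>b\<in>{m, Suc m}. \<exists>S\<in>?\<S>. \<forall>h\<in>S. \<not> X (s, h, b) \<omega>)"
      unfolding box_good.simps site_good_def by blast
    then show "\<omega> \<in> U \<union> (V m \<union> V (Suc m))"
    proof
      assume "\<exists>A\<in>?\<A>. \<forall>(h, b)\<in>cube_cut {..<m} {..<m} A. \<not> X (s, h, b) \<omega>"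
      then show ?thesis using w by (auto simp: U_def C_def FA_def)
    next
      assume "\<exists>b\<in>{m, Suc m}. \<exists>S\<in>?\<S>. \<forall>h\<in>S. \<not> X (s, h, b) \<omega>"
      then show ?thesis using w by (auto simp: V_def C_def FS_def)
    qed
  qed
  then have "prob (bad_box 0 s) \<le> prob (U \<union> (V m \<union> V (Suc m)))"
    using U V by (intro finite_measure_mono) auto
  also have "\<dots> \<le> prob U + prob (V m \<union> V (Suc m))"
    using U V by (intro measure_Un_le) auto
  also have "prob (V m \<union> V (Suc m)) \<le> prob (V m) + prob (V (Suc m))"
    using V by (intro measure_Un_le) auto
  finally have split: "prob (bad_box 0 s) \<le> prob U + (prob (V m) + prob (V (Suc m)))" by simp
  have "prob U \<le> (\<Sum>A\<in>?\<A>. prob (C (FA A)))"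
    unfolding U_def using fin ev by (intro measure_UNION_le) auto
  also have "\<dots> \<le> (\<Sum>A\<in>?\<A>. y ^ card (cube_cut {..<m} {..<m} A))"
  proof (rule sum_mono)
    fix A show "prob (C (FA A)) \<le> y ^ card (cube_cut {..<m} {..<m} A)"
      using prob_all_closed[OF FA(1,2)[of A]] unfolding C_def FA(3) .
  qed
  also have "\<dots> \<le> \<eta>" by fact
  finally have "prob U \<le> \<eta>" .
  moreover have "prob (V b) \<le> \<eta>" if b: "b \<in> {m, Suc m}" for b
  proof -
    have "prob (V b) \<le> (\<Sum>S\<in>?\<S>. prob (C (FS b S)))"
      unfolding V_def using fin ev' b by (intro measure_UNION_le) auto
    also have "\<dots> \<le> (\<Sum>S\<in>?\<S>. y ^ card S)"
    proof (rule sum_mono)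
      fix S assume S: "S \<in> ?\<S>"
      show "prob (C (FS b S)) \<le> y ^ card S"
        using prob_all_closed[OF FS(1,2)[OF S b]] unfolding C_def FS(3)[OF S b] .
    qed
    also have "\<dots> \<le> \<eta>" by fact
    finally show ?thesis .
  qed
  then have "prob (V m) \<le> \<eta>" "prob (V (Suc m)) \<le> \<eta>" by simp_all
  ultimately show ?thesis using split by linarith
qed

text \<open>A bad box has one of at most 81 pairs of bad subboxes, and \<open>81 * q\<^sup>2 \<le> q / 2\<close> for \<open>q \<le> 1 / 162\<close>.\<close>

lemma prob_bad_box_le:
  assumes "\<And>s. prob (bad_box 0 s) \<le> 1 / 162"
  shows "prob (bad_box k z) \<le> 1 / 162 * (1 / 2) ^ k"
proof (induction k arbitrary: z)
  case 0
  then show ?case using assms by simp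
next
  case (Suc k)
  let ?q = "1 / 162 * (1 / 2) ^ k :: real"
  let ?B = "\<lambda>c. bad_box k (subbox z c)"
  let ?P = "{(c, c') \<in> cells \<times> cells. c \<noteq> c'}"
  have fin: "finite ?P" by (rule finite_subset[of _ "cells \<times> cells"]) auto
  have sub: "bad_box (Suc k) z \<subseteq> (\<Union>p\<in>?P. ?B (fst p) \<inter> ?B (snd p))"
  proof
    fix \<omega> assume w: "\<omega> \<in> bad_box (Suc k) z"
    then obtain c c' where "c \<in> cells" "c' \<in> cells" "c \<noteq> c'" "\<omega> \<in> ?B c" "\<omega> \<in> ?B c'"
      unfolding box_good_Suc_iff by blast
    then show "\<omega> \<in> (\<Union>p\<in>?P. ?B (fst p) \<inter> ?B (snd p))"
      by (intro UN_I[of "(c, c')"]) (simp_all only: fst_conv snd_conv mem_Collect_eq case_prod_conv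
          mem_Times_iff Int_iff simp_thms)
  qed
  have "prob (bad_box (Suc k) z) \<le> prob (\<Union>p\<in>?P. ?B (fst p) \<inter> ?B (snd p))"
    using fin bad_box_event by (intro finite_measure_mono[OF sub] sets.finite_UN sets.Int) blast+
  also have "\<dots> \<le> (\<Sum>p\<in>?P. prob (?B (fst p) \<inter> ?B (snd p)))"
    using fin bad_box_event by (intro measure_UNION_le) auto
  also have "\<dots> \<le> (\<Sum>p\<in>?P. ?q * ?q)"
  proof (rule sum_mono)
    fix p assume "p \<in> ?P"
    then have ne: "subbox z (fst p) \<noteq> subbox z (snd p)" by (auto simp: subbox_def)
    show "prob (?B (fst p) \<inter> ?B (snd p)) \<le> ?q * ?q"
      unfolding prob_bad_boxes[OF ne] by (intro mult_mono Suc.IH) auto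
  qed
  also have "\<dots> \<le> 81 * (?q * ?q)"
  proof -
    have "card ?P \<le> card (cells \<times> cells)" by (rule card_mono) auto
    then have "real (card ?P) \<le> 81" by (simp add: card_cartesian_product)
    then show ?thesis by (simp only: sum_constant) (intro mult_right_mono, auto)
  qed
  also have "\<dots> = 1 / 162 * (1 / 2) ^ Suc k * (1 / 2) ^ k" by simp
  also have "\<dots> \<le> 1 / 162 * (1 / 2) ^ Suc k * 1"
    by (intro mult_left_mono power_le_one) auto
  finally show ?case by simp
qed

text \<open>The failure probabilities over all scales sum to at most \<open>1 / 81\<close>, which is
  below 1.\<close>

lemma prob_all_boxes_good:
  assumes "\<And>s. prob (bad_box 0 s) \<le> 1 / 162"
  defines "E \<equiv> {\<omega> \<in> space M. \<forall>k. box_good (site_good d m (\<lambda>i. X i \<omega>)) k (0, 0)}"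
  shows "E \<in> events" "prob E > 0"
proof -
  let ?U = "\<Union>k. bad_box k (0, 0)"
  have U: "?U \<in> events" using bad_box_event by auto
  have E: "E = space M - ?U" unfolding E_def by auto
  then show "E \<in> events" using U by auto
  have sums: "(\<lambda>k. 1 / 162 * (1 / 2) ^ k) sums (1 / 162 * (1 / (1 - 1 / 2 :: real)))"
    by (intro sums_mult geometric_sums) simp
  have summ: "summable (\<lambda>k. prob (bad_box k (0, 0)))"
    by (rule summable_comparison_test'[OF sums_summable[OF sums], of 0])
      (use prob_bad_box_le[OF assms(1)] in simp)
  have "prob ?U \<le> (\<Sum>k. prob (bad_box k (0, 0)))"
    using bad_box_event summ by (intro finite_measure_subadditive_countably) auto
  also have "\<dots> \<le> (\<Sum>k. 1 / 162 * (1 / 2) ^ k)"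
    by (rule suminf_le[OF prob_bad_box_le[OF assms(1)] summ sums_summable[OF sums]])
  also have "\<dots> = 1 / 162 * (1 / (1 - 1 / 2 :: real))" using sums by (rule sums_unique[symmetric])
  finally show "prob E > 0" using prob_compl[OF U] E by simp
qed

end

section \<open>The lattice\<close>

text \<open>An injective selection of coordinates of a product measure has the product of the
  marginals as its law. It is applied to the map from links to lattice edges.\<close>

lemma indep_vars_PiM_reindex:
  assumes N: "\<And>k. k \<in> K \<Longrightarrow> prob_space (N k)"
    and f: "inj_on f I" "f \<in> I \<rightarrow> K" and "I \<noteq> {}"
  shows "prob_space.indep_vars (PiM K N) (\<lambda>i. N (f i)) (\<lambda>i \<omega>. \<omega> (f i)) I"
proof -
  interpret prob_space "PiM K N" by (rule prob_space_PiM) (rule N)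
  have rv: "random_variable (N (f i)) (\<lambda>\<omega>. \<omega> (f i))" if "i \<in> I" for i
    using f that by (intro measurable_component_singleton) auto
  have "distr (PiM K N) (\<Pi>\<^sub>M i\<in>I. N (f i)) (\<lambda>\<omega>. \<lambda>i\<in>I. \<omega> (f i)) = (\<Pi>\<^sub>M i\<in>I. N (f i))"
    by (rule distr_PiM_reindex[OF N f])
  also have "\<dots> = (\<Pi>\<^sub>M i\<in>I. distr (PiM K N) (N (f i)) (\<lambda>\<omega>. \<omega> (f i)))"
    using f by (intro PiM_cong refl distr_PiM_component[symmetric] N) auto
  finally show ?thesis
    by (subst indep_vars_iff_distr_eq_PiM'[OF \<open>I \<noteq> {}\<close> rv])
qed

lemma doubleton_in_edges_iff: "{x, y} \<in> edges \<longleftrightarrow> (\<exists>!i. x $ i \<noteq> y $ i)"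
proof
  assume "{x, y} \<in> edges"
  then obtain u v where uv: "{x, y} = {u, v}" "\<exists>!i. u $ i \<noteq> v $ i"
    unfolding edges_def by blast
  then have "x = u \<and> y = v \<or> x = v \<and> y = u" by (auto simp: doubleton_eq_iff)
  then show "\<exists>!i. x $ i \<noteq> y $ i" using uv(2) by (auto simp: eq_commute)
qed (auto simp: edges_def)

section \<open>Measurability and translation invariance of infinite clusters\<close>

lemma prob_space_percolation: "prob_space (percolation p)"
  unfolding percolation_def by (intro prob_space_PiM) (rule measure_pmf.prob_space_axioms)

lemma cluster_self: "x \<in> cluster \<omega> x"
  by (simp add: cluster_def)

lemma cluster_step:
  assumes "{x, y} \<in> edges" "\<omega> {x, y}"
  shows "cluster \<omega> x = cluster \<omega> y"
proof -
  let ?R = "{(u, v). {u, v} \<in> edges \<and> \<omega> {u, v}}"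
  have "(x, y) \<in> ?R\<^sup>*" "(y, x) \<in> ?R\<^sup>*"
    using assms by (auto simp: insert_commute)
  then show ?thesis by (auto simp: cluster_def intro: rtrancl_trans)
qed

lemma open_edge_event:
  "{\<omega> \<in> space (percolation p). e \<in> edges \<and> \<omega> e} \<in> sets (percolation p)"
proof (cases "e \<in> edges")
  case True
  have "(\<lambda>\<omega>. \<omega> e) \<in> measurable (percolation p) (measure_pmf (bernoulli_pmf (p (edge_length e))))"
    unfolding percolation_def using True by (rule measurable_component_singleton)
  from measurable_sets[OF this, of "{True}"] True show ?thesis
    by (simp add: vimage_def Int_def conj_commute)
qed simp

lemma infinite_cluster_event:
  "{\<omega> \<in> space (percolation p). infinite (cluster \<omega> x)} \<in> sets (percolation p)"
proof -
  let ?R = "\<lambda>\<omega>. {(u, v). {u, v} \<in> edges \<and> \<omega> {u, v}}"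
  have "{\<omega> \<in> space (percolation p). (x, y) \<in> ?R \<omega> ^^ n} \<in> sets (percolation p)" for n y
  proof (induction n arbitrary: y)
    case (Suc n)
    have "(x, y) \<in> ?R \<omega> ^^ Suc n
        \<longleftrightarrow> (\<exists>z. (x, z) \<in> ?R \<omega> ^^ n \<and> ({z, y} \<in> edges \<and> \<omega> {z, y}))" for \<omega> by auto
    then show ?case
      by (simp only:) (intro sets.sets_Collect_countable_Ex sets.sets_Collect_conj Suc.IH open_edge_event)
  qed (simp add: sets.sets_Collect_const)
  then have "{\<omega> \<in> space (percolation p). \<exists>n. (x, y) \<in> ?R \<omega> ^^ n} \<in> sets (percolation p)" for y
    by (intro sets.sets_Collect_countable_Ex)
  then have ev: "{\<omega> \<in> space (percolation p). y \<in> cluster \<omega> x} \<in> sets (percolation p)" for y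
    by (simp add: cluster_def rtrancl_power)
  \<comment> \<open>Lists of vertices form a countable type, so only countable quantifiers occur in
    this form of infiniteness.\<close>
  have eq: "infinite (cluster \<omega> x) \<longleftrightarrow> (\<forall>ys. \<exists>y. y \<in> cluster \<omega> x \<and> y \<notin> set ys)" for \<omega>
    by (metis List.finite_set finite_list finite_subset subsetI)
  show ?thesis
    unfolding eq
    by (intro sets.sets_Collect_countable_All sets.sets_Collect_countable_Ex
        sets.sets_Collect_conj sets.sets_Collect_const ev)
qed

lemma translate_edge:
  fixes v :: "int ^ 'd"
  assumes "e \<in> edges"
  shows "(\<lambda>u. u + v) ` e \<in> edges" "edge_length ((\<lambda>u. u + v) ` e) = edge_length e"
proof -
  obtain x y where e: "e = {x, y}" "\<exists>!i. x $ i \<noteq> y $ i" using assms by (auto simp: edges_def)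
  then obtain i where i: "x $ i \<noteq> y $ i" by auto
  have im: "(\<lambda>u. u + v) ` e = {x + v, y + v}" by (simp add: e)
  have ex: "\<exists>!i. (x + v) $ i \<noteq> (y + v) $ i" using e(2) by simp
  then show "(\<lambda>u. u + v) ` e \<in> edges" unfolding im doubleton_in_edges_iff .
  show "edge_length ((\<lambda>u. u + v) ` e) = edge_length e"
    unfolding im using edge_length_doubleton[OF ex, of i] edge_length_doubleton[OF e(2) i] i e by simp
qed

text \<open>The shift \<open>t\<close> of configurations preserves the product law, and the cluster
  of \<open>v\<close> in \<open>\<omega>\<close>, translated by \<open>- v\<close>, lies in the
  cluster of \<open>0\<close> in \<open>t \<omega>\<close>.\<close>

lemma prob_infinite_cluster_translate:
  fixes v :: "int ^ 'd"
  shows "\<P>(\<omega> in percolation p. infinite (cluster \<omega> v)) 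
    \<le> \<P>(\<omega> in percolation p. infinite (cluster \<omega> (0 :: int ^ 'd)))"
proof -
  define T where "T = (\<lambda>e. (\<lambda>u. u + v) ` e)"
  define N where "N = (\<lambda>e :: (int ^ 'd) set. measure_pmf (bernoulli_pmf (p (edge_length e))))"
  define t where "t = (\<lambda>\<omega> :: (int ^ 'd) set \<Rightarrow> bool. \<lambda>e\<in>edges. \<omega> (T e))"
  let ?M = "percolation p :: ((int ^ 'd) set \<Rightarrow> bool) measure"
  let ?E = "\<lambda>x. {\<omega> \<in> space ?M. infinite (cluster \<omega> x)}"
  have M: "?M = PiM edges N" by (simp add: percolation_def N_def)
  interpret prob_space ?M by (rule prob_space_percolation)
  have T: "T e \<in> edges" "N (T e) = N e" if "e \<in> edges" for e
    using translate_edge[OF that, of v] by (simp_all add: T_def N_def)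
  have inj: "inj_on T edges"
    unfolding T_def by (rule inj_on_subset[OF inj_on_image[of _ UNIV]]) (auto simp: inj_on_def)
  have cong: "PiM edges (\<lambda>e. N (T e)) = ?M" unfolding M by (rule PiM_cong) (auto simp: T)
  have "distr (PiM edges N) (PiM edges (\<lambda>e. N (T e))) (\<lambda>\<omega>. \<lambda>e\<in>edges. \<omega> (T e)) = PiM edges (\<lambda>e. N (T e))"
    using inj T by (intro distr_PiM_reindex) (auto simp: N_def measure_pmf.prob_space_axioms)
  then have distr: "distr ?M ?M t = ?M"
    unfolding cong t_def by (simp add: M)
  have t: "t \<in> measurable ?M ?M"
    unfolding M t_def
  proof (intro measurable_restrict)
    fix e assume "e \<in> (edges :: (int ^ 'd) set set)"
    then show "(\<lambda>\<omega>. \<omega> (T e)) \<in> measurable (PiM edges N) (N e)"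
      using measurable_component_singleton[of "T e" edges N] T[of e] by simp
  qed
  have "?E v \<subseteq> t -` ?E 0 \<inter> space ?M"
  proof
    fix \<omega> assume w: "\<omega> \<in> ?E v"
    have "y - v \<in> cluster (t \<omega>) 0" if "y \<in> cluster \<omega> v" for y
    proof -
      from that have "(v, y) \<in> {(u, v). {u, v} \<in> edges \<and> \<omega> {u, v}}\<^sup>*" by (simp add: cluster_def)
      then show ?thesis
      proof (induction rule: rtrancl_induct)
        case base
        then show ?case by (simp add: cluster_self)
      next
        case (step a b)
        then have ab: "{a, b} \<in> edges" "\<omega> {a, b}" by auto
        have "{a - v, b - v} \<in> edges" using ab(1) unfolding doubleton_in_edges_iff by simp
        moreover have "T {a - v, b - v} = {a, b}" by (simp add: T_def)
        ultimately have "{a - v, b - v} \<in> edges" "t \<omega> {a - v, b - v}" using ab by (simp_all add: t_def)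
        then have "(a - v, b - v) \<in> {(u, v). {u, v} \<in> edges \<and> t \<omega> {u, v}}" by simp
        with step.IH show ?case
          unfolding cluster_def by (auto intro: rtrancl_into_rtrancl)
      qed
    qed
    then have "(\<lambda>y. y - v) ` cluster \<omega> v \<subseteq> cluster (t \<omega>) 0" by blast
    moreover have "infinite ((\<lambda>y. y - v) ` cluster \<omega> v)"
      using w by (subst finite_image_iff) (auto simp: inj_on_def)
    ultimately have "infinite (cluster (t \<omega>) 0)" using finite_subset by blast
    moreover have "t \<omega> \<in> space ?M" using t w by (auto dest: measurable_space)
    ultimately show "\<omega> \<in> t -` ?E 0 \<inter> space ?M" using w by simp
  qed
  then have "prob (?E v) \<le> prob (t -` ?E 0 \<inter> space ?M)"
    using measurable_sets[OF t infinite_cluster_event] by (intro finite_measure_mono)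
  also have "\<dots> = measure (distr ?M ?M t) (?E 0)"
    by (rule measure_distr[OF t infinite_cluster_event, symmetric])
  finally show ?thesis unfolding distr .
qed

section \<open>Superincreasing lengths and the embedding into the lattice\<close>

lemma doubling_sum_less:
  fixes f :: "nat \<Rightarrow> nat"
  assumes "f 0 > 0" "\<And>k. f (Suc k) > 2 * f k"
  shows "(\<Sum>b<k. f b) < f k"
proof (induction k)
  case (Suc k)
  then show ?case using assms(2)[of k] by simp
qed (use assms in simp)

lemma subset_sum_less:
  fixes f :: "nat \<Rightarrow> nat"
  assumes "\<And>k. (\<Sum>b<k. f b) < f k" "h \<subseteq> {..<m}"
  shows "sum f h < f m"
  using sum_mono2[OF _ assms(2), of f] assms(1)[of m] by simp

text \<open>Greedy decoding as for binary expansions: the smaller lengths together stay below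
  \<open>f m\<close>, so the top index belongs to the set exactly when the sum reaches
  \<open>f m\<close>.\<close>

lemma subset_sum_inj:
  fixes f :: "nat \<Rightarrow> nat"
  assumes f: "\<And>k. (\<Sum>b<k. f b) < f k"
  shows "h \<subseteq> {..<m} \<Longrightarrow> h' \<subseteq> {..<m} \<Longrightarrow> sum f h = sum f h' \<Longrightarrow> h = h'"
proof (induction m arbitrary: h h')
  case (Suc m)
  have fin: "finite h" "finite h'" using Suc.prems finite_subset by blast+
  have sub: "h - {m} \<subseteq> {..<m}" "h' - {m} \<subseteq> {..<m}" using Suc.prems by (auto simp: lessThan_Suc)
  have iff: "m \<in> g \<longleftrightarrow> f m \<le> sum f g" if "g \<subseteq> {..<Suc m}" for g
  proof
    assume "m \<in> g"
    then show "f m \<le> sum f g" using finite_subset[OF that] by (intro member_le_sum) auto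
  next
    assume le: "f m \<le> sum f g"
    show "m \<in> g"
    proof (rule ccontr)
      assume "m \<notin> g"
      then have "g \<subseteq> {..<m}" using that by (auto simp: lessThan_Suc)
      then show False using subset_sum_less[of f g m] f le by auto
    qed
  qed
  then have m: "m \<in> h \<longleftrightarrow> m \<in> h'" using Suc.prems by simp
  have "sum f (h - {m}) = sum f (h' - {m})"
    using Suc.prems(3) m fin by (simp add: sum_diff1_nat)
  then have "h - {m} = h' - {m}" by (rule Suc.IH[OF sub])
  then show ?case using m by blast
qed simp

text \<open>The gaps of \<open>f\<close> make the points \<open>sum f h + f m * i\<close> distinct for \<open>h \<subseteq> {..<m}\<close>.\<close>

definition site_embed ::
  "(nat \<Rightarrow> nat) \<Rightarrow> nat \<Rightarrow> 'd \<Rightarrow> 'd \<Rightarrow> (nat \<times> nat) \<times> nat set \<Rightarrow> int ^ 'd" where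
  "site_embed f m a a' v = (\<chi> c. if c = a then int (sum f (snd v) + f m * fst (fst v))
     else if c = a' then int (f m * snd (fst v)) else 0)"

definition embed_link ::
  "(nat \<Rightarrow> nat) \<Rightarrow> nat \<Rightarrow> 'd \<Rightarrow> 'd \<Rightarrow> (nat \<times> nat) \<times> nat set \<times> nat \<Rightarrow> (int ^ 'd) set" where
  "embed_link f m a a' = (\<lambda>(s, h, b). {site_embed f m a a' (s, h), site_embed f m a a' (link_target m s h b)})"

locale lattice_embedding =
  fixes f :: "nat \<Rightarrow> nat" and m :: nat and a a' :: "'d :: finite"
  assumes a: "a \<noteq> a'" and gaps: "\<And>k. (\<Sum>b<k. f b) < f k"
begin

lemma f_pos: "f k > 0"
  using gaps[of k] by simp

lemma f_less: "k < l \<Longrightarrow> f k < f l"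
  using gaps[of l] member_le_sum[of k "{..<l}" f] by (meson finite_lessThan le_less_trans lessThan_iff zero_le)

lemma f_eq_iff: "f k = f l \<longleftrightarrow> k = l"
  using f_less[of k l] f_less[of l k] by (cases k l rule: linorder_cases) auto

lemma site_embed_inj:
  assumes "site_embed f m a a' (s, h) = site_embed f m a a' (s', h')" "h \<subseteq> {..<m}" "h' \<subseteq> {..<m}"
  shows "s = s' \<and> h = h'"
proof -
  have lt: "sum f h < f m" "sum f h' < f m"
    using subset_sum_less[of f] gaps assms(2,3) by blast+
  have "int (sum f h + f m * fst s) = int (sum f h' + f m * fst s')"
    using arg_cong[OF assms(1), of "\<lambda>x. x $ a"] unfolding site_embed_def by simp
  then have eq: "sum f h + f m * fst s = sum f h' + f m * fst s'"
    by (simp only: of_nat_eq_iff)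
  \<comment> \<open>As \<open>sum f h < f m\<close>, division by \<open>f m\<close> separates the
    site coordinate from the subset sum.\<close>
  have "fst s = (sum f h + f m * fst s) div f m" using lt(1) by simp
  also have "\<dots> = fst s'" unfolding eq using lt(2) by simp
  finally have 1: "fst s = fst s'" .
  with eq have "sum f h = sum f h'" by simp
  then have 2: "h = h'" using assms(2,3) by (intro subset_sum_inj[of f h m h'] gaps)
  have "int (f m * snd s) = int (f m * snd s')"
    using arg_cong[OF assms(1), of "\<lambda>x. x $ a'"] a unfolding site_embed_def by simp
  then have "snd s = snd s'" using f_pos[of m] by (simp only: of_nat_eq_iff) simp
  with 1 2 show ?thesis by (simp add: prod_eq_iff)
qed

definition link_dir :: "nat \<Rightarrow> 'd" where
  "link_dir b = (if b \<le> m then a else a')"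

text \<open>The directions \<open>m\<close> and \<open>Suc m\<close> share the length
  \<open>f m\<close> and differ only in the axis, hence \<open>min b m\<close>.\<close>

lemma site_embed_target:
  assumes "(s, h, b) \<in> link_set m"
  shows "site_embed f m a a' (link_target m s h b)
    = site_embed f m a a' (s, h) + axis (link_dir b) (int (f (min b m)))"
proof -
  have "finite h" "b \<notin> h" "b \<le> Suc m" using assms finite_subset by (auto simp: link_set_def)
  then show ?thesis
    using a by (auto simp: vec_eq_iff site_embed_def link_target_def link_dir_def axis_def algebra_simps
        min_def le_Suc_eq)
qed

lemma embed_link_edge:
  assumes "(s, h, b) \<in> link_set m"
  shows "embed_link f m a a' (s, h, b) \<in> edges"
    and "edge_length (embed_link f m a a' (s, h, b)) = f (min b m)"
proof -
  let ?x = "site_embed f m a a' (s, h)" and ?y = "site_embed f m a a' (link_target m s h b)"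
  have d: "?y $ c - ?x $ c = (if c = link_dir b then int (f (min b m)) else 0)" for c
    by (simp add: site_embed_target[OF assms] axis_def)
  have iff: "?x $ c \<noteq> ?y $ c \<longleftrightarrow> c = link_dir b" for c
    using d[of c] f_pos[of "min b m"] by (auto split: if_splits)
  then have ex: "\<exists>!c. ?x $ c \<noteq> ?y $ c" by auto
  then show "embed_link f m a a' (s, h, b) \<in> edges"
    by (simp add: embed_link_def doubleton_in_edges_iff)
  have "edge_length {?x, ?y} = nat \<bar>?x $ link_dir b - ?y $ link_dir b\<bar>"
    by (rule edge_length_doubleton[OF ex]) (simp add: iff)
  also have "\<dots> = f (min b m)" using d[of "link_dir b"] by simp
  finally show "edge_length (embed_link f m a a' (s, h, b)) = f (min b m)"
    by (simp add: embed_link_def)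
qed

text \<open>This makes the states of distinct links independent. The lower endpoint of the edge
  determines \<open>s\<close> and \<open>h\<close>, the displacement determines
  \<open>b\<close>.\<close>

lemma inj_embed_link: "inj_on (embed_link f m a a') (link_set m)"
proof (rule inj_onI)
  fix i j assume "i \<in> link_set m" "j \<in> link_set m" and eq: "embed_link f m a a' i = embed_link f m a a' j"
  moreover obtain s h b s' h' b' where i: "i = (s, h, b)" "j = (s', h', b')"
    by (cases i, cases j)
  ultimately have L: "(s, h, b) \<in> link_set m" "(s', h', b') \<in> link_set m" by auto
  define u where "u = site_embed f m a a' (s, h)"
  define u' where "u' = site_embed f m a a' (s', h')"
  define w where "w = axis (link_dir b) (int (f (min b m)))"
  define w' where "w' = axis (link_dir b') (int (f (min b' m)))"
  have "{u, u + w} = {u', u' + w'}"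
    using eq site_embed_target[OF L(1)] site_embed_target[OF L(2)]
    by (simp add: i embed_link_def u_def u'_def w_def w'_def)
  \<comment> \<open>Both displacements point in positive axis directions, so the two edges cannot
    coincide with opposite orientations.\<close>
  moreover have "w + w' \<noteq> 0"
  proof
    assume "w + w' = 0"
    then have "(w + w') $ link_dir b = 0" by simp
    then show False using f_pos[of "min b m"] by (auto simp: w_def w'_def axis_def split: if_splits)
  qed
  ultimately have "u = u'" "w = w'" by (auto simp: doubleton_eq_iff algebra_simps)
  then have sh: "s = s' \<and> h = h'"
    using L by (intro site_embed_inj) (auto simp: u_def u'_def link_set_def)
  have "link_dir b = link_dir b' \<and> f (min b m) = f (min b' m)"
    using arg_cong[OF \<open>w = w'\<close>, of "\<lambda>x. x $ link_dir b"] f_pos[of "min b m"]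
    by (auto simp: w_def w'_def axis_def split: if_splits)
  then have "b = b'"
    using L a by (auto simp: link_dir_def link_set_def f_eq_iff min_def split: if_splits)
  with sh show "i = j" by (simp add: i)
qed

lemma infinite_cluster_embed:
  assumes "h \<subseteq> {..<m}"
    and inf: "infinite (component (open_links m (\<lambda>i. \<omega> (embed_link f m a a' i))) (s, h))"
  shows "infinite (cluster \<omega> (site_embed f m a a' (s, h)))"
proof -
  let ?e = "site_embed f m a a'"
  let ?C = "component (open_links m (\<lambda>i. \<omega> (embed_link f m a a' i))) (s, h)"
  \<comment> \<open>Injectivity of the embedding is available only for such vertices; the property
    is preserved along links.\<close>
  have valid: "snd v \<subseteq> {..<m}" if "v \<in> ?C" for v
  proof -
    have "(snd v \<subseteq> {..<m}) = (snd (s, h) \<subseteq> {..<m})"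
      by (rule component_constant[OF _ that])
        (auto simp: open_links_def link_set_def link_target_def split: if_splits)
    then show ?thesis using assms(1) by simp
  qed
  have "cluster \<omega> (?e v) = cluster \<omega> (?e (s, h))" if "v \<in> ?C" for v
  proof (rule component_constant[OF _ that])
    fix u w assume "(u, w) \<in> open_links m (\<lambda>i. \<omega> (embed_link f m a a' i))"
    then obtain t g b where u: "u = (t, g)" "w = link_target m t g b" "(t, g, b) \<in> link_set m"
        "\<omega> (embed_link f m a a' (t, g, b))"
      by (auto simp: open_links_def)
    then show "cluster \<omega> (?e u) = cluster \<omega> (?e w)"
      using embed_link_edge(1)[OF u(3)] by (intro cluster_step) (simp_all add: embed_link_def)
  qed
  then have sub: "?e ` ?C \<subseteq> cluster \<omega> (?e (s, h))" using cluster_self by blast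
  have "inj_on ?e ?C"
  proof (rule inj_onI)
    fix v w assume "v \<in> ?C" "w \<in> ?C" "?e v = ?e w"
    then show "v = w"
      using site_embed_inj[of "fst v" "snd v" "fst w" "snd w"] valid by (simp add: prod_eq_iff)
  qed
  then have "infinite (?e ` ?C)" using inf finite_image_iff by blast
  then show ?thesis using sub finite_subset by blast
qed

end

section \<open>Choice of the lengths and conclusion\<close>

lemma limsup_pos_frequently:
  fixes p :: "nat \<Rightarrow> real"
  assumes "limsup (\<lambda>n. ereal (p n)) > 0"
  obtains \<epsilon> where "\<epsilon> > 0" "\<And>k. \<exists>n\<ge>k. \<epsilon> < p n"
proof -
  obtain \<epsilon> where e: "0 < ereal \<epsilon>" "ereal \<epsilon> < limsup (\<lambda>n. ereal (p n))"
    using ereal_dense2[OF assms] by blast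
  have "\<exists>n\<ge>k. \<epsilon> < p n" for k
  proof (rule ccontr)
    assume "\<not> ?thesis"
    then have "eventually (\<lambda>n. ereal (p n) \<le> ereal \<epsilon>) sequentially"
      by (auto simp: eventually_sequentially not_less)
    then have "limsup (\<lambda>n. ereal (p n)) \<le> ereal \<epsilon>" by (rule Limsup_bounded)
    then show False using e by simp
  qed
  then show ?thesis using that[of \<epsilon>] e by simp
qed

lemma exists_doubling_sequence:
  assumes "\<And>k :: nat. \<exists>n\<ge>k. P n"
  shows "\<exists>f :: nat \<Rightarrow> nat. \<forall>k. P (f k) \<and> (\<Sum>b<k. f b) < f k"
proof -
  have "\<exists>f. \<forall>k. (P (f k) \<and> f k > 0) \<and> f (Suc k) > 2 * f k"
  proof (rule dependent_nat_choice)
    show "\<exists>n. P n \<and> n > 0" using assms[of 1] by auto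
    show "\<exists>n'. (P n' \<and> n' > 0) \<and> n' > 2 * n" for n
      using assms[of "Suc (2 * n)"] by (auto simp: Suc_le_eq)
  qed
  then obtain f where "\<And>k. P (f k)" "f 0 > 0" "\<And>k. f (Suc k) > 2 * f k" by blast
  then show ?thesis using doubling_sum_less[of f] by blast
qed

theorem theorem1:
  fixes p :: "nat \<Rightarrow> real"
  assumes "CARD('d::finite) \<ge> 2"
    and "\<And>n. n \<ge> 1 \<Longrightarrow> 0 \<le> p n \<and> p n \<le> 1"
    and "limsup (\<lambda>n. ereal (p n)) > 0"
  shows "\<exists>N. \<P>(\<omega> in (truncated_percolation N p :: ((int ^ 'd) set \<Rightarrow> bool) measure).
           infinite (cluster \<omega> 0)) > 0"
proof -
  obtain \<epsilon> where e: "\<epsilon> > 0" "\<And>k. \<exists>n\<ge>k. \<epsilon> < p n"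
    using limsup_pos_frequently[OF assms(3)] by blast
  obtain f :: "nat \<Rightarrow> nat" where "\<forall>k. \<epsilon> < p (f k) \<and> (\<Sum>b<k. f b) < f k"
    using exists_doubling_sequence[of "\<lambda>n. \<epsilon> < p n", OF e(2)] by (elim exE)
  then have f: "\<epsilon> < p (f k)" "(\<Sum>b<k. f b) < f k" for k by simp_all
  have fpos: "f k \<ge> 1" for k using f(2)[of k] by simp
  have "\<epsilon> < 1" using f(1)[of 0] assms(2)[OF fpos, of 0] by simp
  define y where "y = 1 - \<epsilon>"
  have y: "0 < y" "y < 1" using e(1) \<open>\<epsilon> < 1\<close> by (auto simp: y_def)
  \<comment> \<open>Three failures of probability at most \<open>1 / 486\<close> give
    \<open>1 / 162\<close>, the threshold of the renormalisation.\<close>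
  have "(0::real) < 1 / 486" by simp
  from exists_cube_parameters[OF y this]
  obtain d :: real and m :: nat where d: "0 < d" "d \<le> 1 / 3" and
    sums: "(\<Sum>A | A \<subseteq> Pow {..<m} \<and> d * 2 ^ m \<le> card A \<and> card A \<le> (1 - d) * 2 ^ m.
        y ^ card (cube_cut {..<m} {..<m} A)) \<le> 1 / 486"
    "(\<Sum>S | S \<subseteq> Pow {..<m} \<and> (1 - 2 * d) * 2 ^ m \<le> card S. y ^ card S) \<le> 1 / 486"
    .
  obtain a a' :: 'd where a: "a \<noteq> a'"
    using assms(1) card_le_Suc0_iff_eq[of "UNIV :: 'd set"] by fastforce
  interpret lattice_embedding f m a a' by unfold_locales (use a f(2) in auto)
  \<comment> \<open>The truncation level \<open>f m\<close> is the longest length in use, so every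
    link keeps its original probability.\<close>
  define M where "M = (truncated_percolation (f m) p :: ((int ^ 'd) set \<Rightarrow> bool) measure)"
  have M: "M = percolation (truncate (f m) p)" by (simp add: M_def truncated_percolation_def)
  define N where "N = (\<lambda>e :: (int ^ 'd) set. measure_pmf (bernoulli_pmf (truncate (f m) p (edge_length e))))"
  have MN: "M = PiM edges N" by (simp add: M percolation_def N_def)
  have N: "prob_space (N e)" for e by (simp add: N_def measure_pmf.prob_space_axioms)
  let ?e = "embed_link f m a a'"
  have edge: "?e i \<in> edges" if "i \<in> link_set m" for i
    using that embed_link_edge(1) by (cases i) auto
  interpret prob_space M unfolding M by (rule prob_space_percolation)
  have closed: "prob {\<omega> \<in> space M. \<not> \<omega> (?e i)} \<le> y" if i: "i \<in> link_set m" for i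
  proof -
    obtain s h b where sh: "i = (s, h, b)" by (cases i)
    let ?l = "f (min b m)"
    have len: "edge_length (?e i) = ?l" using embed_link_edge(2) i sh by simp
    have "?l \<le> f m" using f_less[of b m] by (cases "b < m") (auto simp: min_def)
    then have tr: "truncate (f m) p ?l = p ?l" by (simp add: truncate_def)
    have meas: "(\<lambda>\<omega>. \<omega> (?e i)) \<in> measurable M (N (?e i))"
      unfolding MN using edge[OF i] by (rule measurable_component_singleton)
    have "prob {\<omega> \<in> space M. \<not> \<omega> (?e i)} = measure (distr M (N (?e i)) (\<lambda>\<omega>. \<omega> (?e i))) {False}"
      by (subst measure_distr[OF meas]) (auto simp: N_def intro!: arg_cong[where f = prob])
    also have "distr M (N (?e i)) (\<lambda>\<omega>. \<omega> (?e i)) = N (?e i)"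
      unfolding MN by (rule distr_PiM_component[OF N edge[OF i]])
    also have "measure (N (?e i)) {False} = 1 - p ?l"
      using assms(2)[OF fpos, of "min b m"] by (simp add: N_def len tr measure_pmf_single)
    also have "\<dots> \<le> y" using f(1)[of "min b m"] by (simp add: y_def)
    finally show ?thesis .
  qed
  have ne: "link_set m \<noteq> {}" by (auto simp: link_set_def)
  have "indep_vars (\<lambda>i. N (?e i)) (\<lambda>i \<omega>. \<omega> (?e i)) (link_set m)"
    unfolding MN using edge by (intro indep_vars_PiM_reindex N inj_embed_link ne) auto
  then have "indep_vars (\<lambda>_. count_space UNIV) (\<lambda>i \<omega>. \<omega> (?e i)) (link_set m)"
    by (rule indep_vars_compose2[where Y = "\<lambda>_ x. x"]) (simp add: N_def)
  then interpret site_bonds M "\<lambda>i \<omega>. \<omega> (?e i)" m y d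
    using closed by unfold_locales
  define E where "E = {\<omega> \<in> space M. \<forall>k. box_good (site_good d m (\<lambda>i. \<omega> (?e i))) k (0, 0)}"
  have "prob (bad_box 0 s) \<le> 1 / 162" for s
    using prob_bad_site_le[OF sums, of s] by simp
  then have E: "E \<in> events" "prob E > 0"
    unfolding E_def by (rule prob_all_boxes_good)+
  define Q where "Q x = {\<omega> \<in> space M. infinite (cluster \<omega> x)}" for x
  have Q: "Q x \<in> events" for x unfolding Q_def M by (rule infinite_cluster_event)
  let ?v = "\<lambda>h. site_embed f m a a' ((0, 0), h)"
  \<comment> \<open>The infinite component starts at one of the \<open>2 ^ m\<close> vertices of the
    corner copy. A union bound followed by translation to \<open>0\<close> costs only a factor
    \<open>2 ^ m\<close>.\<close>
  have "E \<subseteq> (\<Union>h\<in>Pow {..<m}. Q (?v h))"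
  proof
    fix \<omega> assume w: "\<omega> \<in> E"
    then obtain h where "h \<subseteq> {..<m}"
        "infinite (component (open_links m (\<lambda>i. \<omega> (?e i))) ((0, 0), h))"
      using infinite_component_links[OF d, of m "\<lambda>i. \<omega> (?e i)"] unfolding E_def by blast
    then have "\<omega> \<in> Q (?v h)"
      using infinite_cluster_embed w unfolding Q_def E_def by blast
    then show "\<omega> \<in> (\<Union>h\<in>Pow {..<m}. Q (?v h))" using \<open>h \<subseteq> {..<m}\<close> by blast
  qed
  then have "prob E \<le> prob (\<Union>h\<in>Pow {..<m}. Q (?v h))"
    using Q by (intro finite_measure_mono sets.finite_UN) auto
  also have "\<dots> \<le> (\<Sum>h\<in>Pow {..<m}. prob (Q (?v h)))"
    using Q by (intro measure_UNION_le) auto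
  also have "\<dots> \<le> (\<Sum>h\<in>Pow {..<m}. prob (Q 0))"
    unfolding Q_def M by (intro sum_mono prob_infinite_cluster_translate)
  finally have "prob E \<le> 2 ^ m * prob (Q 0)" by (simp add: card_Pow)
  then have "prob (Q 0) > 0"
    using E(2) by (smt (verit) measure_nonneg mult_eq_0_iff)
  then show ?thesis unfolding Q_def M_def by blast
qed

end
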